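(* Let $N$ be a positive integer and $\delta,\alpha$ real numbers with $\delta\le 1/8$ and $640N^{-1/2}<\alpha\le 2^{-27}\delta$. Let $\Lambda\subseteq\mathbb{Z}_N$ belong to the family $\Lambda\big((\delta/\alpha)^2,(\delta/\alpha)^2,\lfloor\log(1/\delta)\rfloor\big)$ and satisfy $|\Lambda|\le 2^{-12}(\delta/\alpha)^2\log(1/\delta)$. Then there exists a set $A\subseteq\mathbb{Z}_N$ with $|A|=\lfloor\delta N\rfloor$ such that $\mathcal{R}_\alpha(A)=\{0\}\sqcup\Lambda\sqcup(-\Lambda)$.
   Context: $\mathbb{Z}_N=\mathbb{Z}/N\mathbb{Z}$; $\log$ is the logarithm to base $2$. For $f:\mathbb{Z}_N\to\mathbb{C}$, $\widehat f(r)=\sum_{n}f(n)e^{2\pi i nr/N}$; $A(x)$ is the indicator of $A$, and $\mathcal{R}_\alpha(A)=\{r\in\mathbb{Z}_N:|\widehat A(r)|\ge\alpha N\}$. Family $\Lambda(k,s,p)$: for positive integers $k,p$ and $s$ a positive integer or $\infty$, a set $\Lambda\subseteq\mathbb{Z}_N$ belongs to $\Lambda(k,s,p)$ if there is a partition of $\Lambda$ into $p$ subsets $\Lambda_1=\{\lambda^{(1)}_1,\dots,\lambda^{(1)}_{|\Lambda_1|}\},\dots,\Lambda_p=\{\lambda^{(p)}_1,\dots,\lambda^{(p)}_{|\Lambda_p|}\}$ such that the cardinalities of any two subsets $\Lambda_i,\Lambda_j$ differ by at most a factor of two, and such that any relation $\sum_{i=1}^p\sum_{j=1}^{|\Lambda_i|}s^{(i)}_j\lambda^{(i)}_j\equiv0\pmod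 N$ with integers $s^{(i)}_j$ satisfying $|s^{(i)}_j|\le s$ for all $i,j$ and $\sum_{j=1}^{|\Lambda_i|}|s^{(i)}_j|\le k$ for each $i=1,\dots,p$ forces all $s^{(i)}_j=0$. *)

theory Defs
  imports Complex_Main "HOL-Library.Extended_Real"
begin

definition ZN :: "nat \<Rightarrow> int set" where
  "ZN N = {0..<int N}"

definition fourier_ind :: "nat \<Rightarrow> int set \<Rightarrow> int \<Rightarrow> complex" where
  "fourier_ind N A r = (\<Sum>n\<in>A. cis (2 * pi * of_int n * of_int r / of_nat N))"

definition large_spectrum :: "nat \<Rightarrow> real \<Rightarrow> int set \<Rightarrow> int set" where
  "large_spectrum N \<alpha> A = {r \<in> ZN N. cmod (fourier_ind N A r) \<ge> \<alpha> * of_nat N}"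

definition neg_set :: "nat \<Rightarrow> int set \<Rightarrow> int set" where
  "neg_set N L = (\<lambda>x. (- x) mod int N) ` L"

text \<open>The family Lambda(k,s,p): s may be infinite (ereal); k is allowed to be real
  (the bound on integer coefficients is then effectively its floor).  The coefficients
  s^{(i)}_j are given as a function c on the elements of Lambda (the blocks are disjoint).\<close>
definition in_Lambda_family :: "nat \<Rightarrow> real \<Rightarrow> ereal \<Rightarrow> nat \<Rightarrow> int set \<Rightarrow> bool" where
  "in_Lambda_family N k s p L \<longleftrightarrow> L \<subseteq> ZN N \<and>
     (\<exists>P :: nat \<Rightarrow> int set.
        (\<Union>i<p. P i) = L \<and>
        (\<forall>i<p. \<forall>j<p. i \<noteq> j \<longrightarrow> P i \<inter> P j = {}) \<and>
        (\<forall>i<p. \<forall>j<p. card (P i) \<le> 2 * card (P j)) \<and>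
        (\<forall>c :: int \<Rightarrow> int.
           ((\<forall>x\<in>L. ereal (of_int \<bar>c x\<bar>) \<le> s) \<and>
            (\<forall>i<p. of_int (\<Sum>x\<in>P i. \<bar>c x\<bar>) \<le> k) \<and>
            (\<Sum>x\<in>L. c x * x) mod int N = 0)
           \<longrightarrow> (\<forall>x\<in>L. c x = 0)))"

end

(*
  Take f(x) = d * prod_i (1 + Im (prod_{l in Lambda_i} (1 + i a cos(2 pi l x / N))) / 2) with
  d = floor(delta N) / N and a = 16 alpha / delta.  The cardinality bound on Lambda makes
  a^2 |Lambda_i| <= 1, so every factor lies in [0, 2] and 0 <= f <= 1.  Since Lambda is dissociated
  in blocks, different sign patterns give different frequencies; hence the Fourier transform of f is
  d N at 0 and d N a / 4 >= 2 alpha N on Lambda and -Lambda, while elsewhere at least two frequencies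
  are involved and it is at most d N (a / 2)^2, which is tiny compared with alpha N.

  It remains to round f to the indicator of a set with Fourier error less than 640 sqrt N.
  Independent random rounding would lose a logarithm, so Spencer's partial colouring method is used:
  among the sign patterns on n points, exponentially many give nearly equal values to all m linear
  forms, two of them differ in at least n / 4 places, and half their difference is a partial
  colouring of discrepancy 4 (m n)^(1/4).  Iterating gives full colourings, and colouring the odd
  places digit by digit rounds arbitrary weights in [0, 1].
*)
theory Submission
  imports Defs "HOL-Library.FuncSet" "HOL-Library.Real_Mod"
begin

section \<open>Moments of random signed sums\<close>

text \<open>A sign pattern is encoded by the set \<open>T\<close> of points with sign plus; points
  of \<open>T\<close> outside \<open>S\<close> have no effect. Sums over \<open>Pow S\<close>,
  divided by \<open>2 ^ card S\<close>, are expectations over random signs.\<close>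

definition signed_sum :: "('a \<Rightarrow> real) \<Rightarrow> 'a set \<Rightarrow> 'a set \<Rightarrow> real" where
  "signed_sum a S T = (\<Sum>x\<in>S. if x \<in> T then a x else - a x)"

lemma sum_Pow_insert:
  fixes g :: "'a set \<Rightarrow> 'b::comm_monoid_add"
  assumes "finite S" "y \<notin> S"
  shows "(\<Sum>T\<in>Pow (insert y S). g T) = (\<Sum>T\<in>Pow S. g T + g (insert y T))"
proof -
  have inj: "inj_on (insert y) (Pow S)"
    using assms(2) by (auto simp: inj_on_def)
  have "(\<Sum>T\<in>Pow (insert y S). g T) = (\<Sum>T\<in>Pow S. g T) + (\<Sum>T\<in>insert y ` Pow S. g T)"
    unfolding Pow_insert by (rule sum.union_disjoint) (use assms in auto)
  also have "(\<Sum>T\<in>insert y ` Pow S. g T) = (\<Sum>T\<in>Pow S. g (insert y T))"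
    by (simp add: sum.reindex[OF inj])
  finally show ?thesis by (simp add: sum.distrib)
qed

lemma signed_sum_insert:
  assumes "finite S" "y \<notin> S" "T \<subseteq> S"
  shows "signed_sum a (insert y S) T = signed_sum a S T - a y"
    and "signed_sum a (insert y S) (insert y T) = signed_sum a S T + a y"
proof -
  have "y \<notin> T" using assms by auto
  then show "signed_sum a (insert y S) T = signed_sum a S T - a y"
    using assms by (simp add: signed_sum_def)
  have "(\<Sum>x\<in>S. if x \<in> insert y T then a x else - a x) = (\<Sum>x\<in>S. if x \<in> T then a x else - a x)"
    using assms(2) by (intro sum.cong) auto
  then show "signed_sum a (insert y S) (insert y T) = signed_sum a S T + a y"
    using assms by (simp add: signed_sum_def)
qed

text \<open>Conditioning on the sign of the new point \<open>y\<close>. For an even power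
  \<open>h\<close> the odd terms of the two expansions cancel, so each even moment satisfies a
  recursion in the lower even moments.\<close>

lemma sum_signed_sum_insert:
  assumes "finite S" "y \<notin> S"
  shows "(\<Sum>T\<in>Pow (insert y S). h (signed_sum a (insert y S) T)) =
    (\<Sum>T\<in>Pow S. h (signed_sum a S T - a y) + h (signed_sum a S T + a y) :: real)"
  unfolding sum_Pow_insert[OF assms]
  by (intro sum.cong refl) (simp add: signed_sum_insert[OF assms])

lemma second_moment:
  assumes "finite S" "\<And>x. x \<in> S \<Longrightarrow> \<bar>a x\<bar> \<le> 1"
  shows "(\<Sum>T\<in>Pow S. signed_sum a S T ^ 2) \<le> real (card S) * 2 ^ card S"
  using assms
proof (induction S rule: finite_induct)
  case empty
  show ?case by (simp add: signed_sum_def)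
next
  case (insert y S)
  have ay: "(a y)^2 \<le> 1" using insert.prems[of y] by (simp add: abs_square_le_1)
  have "(\<Sum>T\<in>Pow (insert y S). signed_sum a (insert y S) T ^ 2) =
      (\<Sum>T\<in>Pow S. 2 * signed_sum a S T ^ 2 + 2 * (a y)^2)"
    unfolding sum_signed_sum_insert[OF insert.hyps, where h = "\<lambda>v. v ^ 2"]
    by (intro sum.cong refl) (simp add: power2_eq_square algebra_simps)
  also have "\<dots> = 2 * (\<Sum>T\<in>Pow S. signed_sum a S T ^ 2) + 2 * (a y)^2 * 2 ^ card S"
    using insert.hyps by (simp add: sum.distrib sum_distrib_left card_Pow)
  also have "\<dots> \<le> 2 * (real (card S) * 2 ^ card S) + 2 * 1 * 2 ^ card S"
    using insert ay by (intro add_mono mult_left_mono mult_right_mono) auto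
  finally show ?case using insert.hyps by (simp add: algebra_simps)
qed

lemma fourth_moment:
  assumes "finite S" "\<And>x. x \<in> S \<Longrightarrow> \<bar>a x\<bar> \<le> 1"
  shows "(\<Sum>T\<in>Pow S. signed_sum a S T ^ 4) \<le> 3 * real (card S) ^ 2 * 2 ^ card S"
  using assms
proof (induction S rule: finite_induct)
  case empty
  show ?case by (simp add: signed_sum_def)
next
  case (insert y S)
  let ?n = "real (card S)"
  let ?M2 = "\<Sum>T\<in>Pow S. signed_sum a S T ^ 2"
  let ?M4 = "\<Sum>T\<in>Pow S. signed_sum a S T ^ 4"
  have ay: "(a y)^2 \<le> 1" using insert.prems[of y] by (simp add: abs_square_le_1)
  have ay4: "(a y)^4 \<le> 1" using power_mono[OF ay, of 2] by simp
  have eq: "(u - v) ^ 4 + (u + v) ^ 4 = 2 * u ^ 4 + 12 * v ^ 2 * u ^ 2 + 2 * v ^ 4" for u v :: real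
    by algebra
  have "(\<Sum>T\<in>Pow (insert y S). signed_sum a (insert y S) T ^ 4) =
      (\<Sum>T\<in>Pow S. 2 * signed_sum a S T ^ 4 + 12 * (a y)^2 * signed_sum a S T ^ 2 + 2 * (a y)^4)"
    unfolding sum_signed_sum_insert[OF insert.hyps, where h = "\<lambda>v. v ^ 4"] eq ..
  also have "\<dots> = 2 * ?M4 + 12 * ((a y)^2 * ?M2) + 2 * (a y)^4 * 2 ^ card S"
    using insert.hyps by (simp add: sum.distrib sum_distrib_left card_Pow mult.assoc)
  also have "\<dots> \<le> 2 * (3 * ?n ^ 2 * 2 ^ card S) + 12 * (1 * (?n * 2 ^ card S)) + 2 * 1 * 2 ^ card S"
    using insert ay ay4 by (intro add_mono mult_left_mono mult_right_mono mult_mono second_moment sum_nonneg) auto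
  also have "\<dots> \<le> 3 * (?n + 1)^2 * 2 ^ (card S + 1)"
    by (simp add: power2_eq_square algebra_simps)
  finally show ?case using insert.hyps by (simp add: add.commute)
qed

text \<open>The constants 1, 3, 15 of the three moments are those of a standard Gaussian. The sixth
  power is the one that balances a series bound exp (4 / \<kappa>^2) at a discrepancy of order (m
  n)^(1/4) for m forms on n points.\<close>

lemma sixth_moment:
  assumes "finite S" "\<And>x. x \<in> S \<Longrightarrow> \<bar>a x\<bar> \<le> 1"
  shows "(\<Sum>T\<in>Pow S. signed_sum a S T ^ 6) \<le> 15 * real (card S) ^ 3 * 2 ^ card S"
  using assms
proof (induction S rule: finite_induct)
  case empty
  show ?case by (simp add: signed_sum_def)
next
  case (insert y S)
  let ?n = "real (card S)"
  let ?M2 = "\<Sum>T\<in>Pow S. signed_sum a S T ^ 2"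
  let ?M4 = "\<Sum>T\<in>Pow S. signed_sum a S T ^ 4"
  let ?M6 = "\<Sum>T\<in>Pow S. signed_sum a S T ^ 6"
  have ay: "(a y)^2 \<le> 1" using insert.prems[of y] by (simp add: abs_square_le_1)
  have ay4: "(a y)^4 \<le> 1" using power_mono[OF ay, of 2] by simp
  have ay6: "(a y)^6 \<le> 1" using power_mono[OF ay, of 3] by simp
  have eq: "(u - v) ^ 6 + (u + v) ^ 6 = 2 * u ^ 6 + 30 * v ^ 2 * u ^ 4 + 30 * v ^ 4 * u ^ 2 + 2 * v ^ 6"
    for u v :: real
    by algebra
  have "(\<Sum>T\<in>Pow (insert y S). signed_sum a (insert y S) T ^ 6) =
      (\<Sum>T\<in>Pow S. 2 * signed_sum a S T ^ 6 + 30 * (a y)^2 * signed_sum a S T ^ 4 +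
         30 * (a y)^4 * signed_sum a S T ^ 2 + 2 * (a y)^6)"
    unfolding sum_signed_sum_insert[OF insert.hyps, where h = "\<lambda>v. v ^ 6"] eq ..
  also have "\<dots> = 2 * ?M6 + 30 * ((a y)^2 * ?M4) + 30 * ((a y)^4 * ?M2) + 2 * (a y)^6 * 2 ^ card S"
    using insert.hyps by (simp add: sum.distrib sum_distrib_left card_Pow mult.assoc)
  also have "\<dots> \<le> 2 * (15 * ?n ^ 3 * 2 ^ card S) + 30 * (1 * (3 * ?n ^ 2 * 2 ^ card S)) +
      30 * (1 * (?n * 2 ^ card S)) + 2 * 1 * 2 ^ card S"
    using insert ay ay4 ay6
    by (intro add_mono mult_left_mono mult_right_mono mult_mono second_moment fourth_moment sum_nonneg) auto
  also have "\<dots> \<le> 15 * (?n + 1)^3 * 2 ^ (card S + 1)"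
    by (simp add: power2_eq_square power3_eq_cube algebra_simps)
  finally show ?case using insert.hyps by (simp add: add.commute)
qed

text \<open>Since k^6 >= k, the positive half is dominated by a geometric series with sum 1 / (exp
  \<kappa> - 1) <= 2 / \<kappa>^2. The bound is uniform in \<open>R\<close>, and its exponential
  form multiplies well over many coordinates.\<close>

lemma sum_exp_sixth_power_le:
  fixes \<kappa> :: real
  assumes "\<kappa> > 0"
  shows "(\<Sum>b\<in>{- int R..int R}. exp (- \<kappa> * real_of_int b ^ 6)) \<le> exp (4 / \<kappa>\<^sup>2)"
proof -
  define q where "q = exp (- \<kappa>)"
  have q: "0 < q" "q < 1" using assms by (auto simp: q_def)
  have eq: "{- int R..int R} = (\<lambda>k. - int k) ` {1..R} \<union> ({0} \<union> int ` {1..R})"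
  proof (intro subset_antisym subsetI)
    fix b assume b: "b \<in> {- int R..int R}"
    consider "b = - int (nat (- b))" "b < 0" | "b = 0" | "b = int (nat b)" "b > 0" by linarith
    then show "b \<in> (\<lambda>k. - int k) ` {1..R} \<union> ({0} \<union> int ` {1..R})"
    proof cases
      case 1
      then show ?thesis using b by (intro UnI1 image_eqI[where x = "nat (- b)"]) auto
    next
      case 3
      then show ?thesis using b by (intro UnI2 image_eqI[where x = "nat b"]) auto
    qed simp
  qed auto
  have term_le: "exp (- \<kappa> * real k ^ 6) \<le> q ^ k" if "k \<ge> 1" for k :: nat
  proof -
    have "real k ^ 1 \<le> real k ^ 6" using that by (intro power_increasing) auto
    then show ?thesis
      using assms by (simp add: q_def flip: exp_of_nat_mult)
  qed
  have "(\<Sum>k\<in>{1..R}. exp (- \<kappa> * real k ^ 6)) \<le> (\<Sum>k\<in>{1..R}. q ^ k)"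
    by (intro sum_mono term_le) auto
  also have "\<dots> \<le> q / (1 - q)"
    using q by (auto simp: sum_gp divide_simps)
  also have "\<dots> = 1 / (exp \<kappa> - 1)"
    using assms by (simp add: q_def exp_minus field_simps)
  also have "\<dots> \<le> 2 / \<kappa>\<^sup>2"
  proof -
    have "1 + \<kappa> + \<kappa>\<^sup>2 / 2 \<le> exp \<kappa>" using assms by (intro exp_lower_Taylor_quadratic) auto
    then have "\<kappa>\<^sup>2 / 2 \<le> exp \<kappa> - 1" using assms by linarith
    moreover have "\<kappa>\<^sup>2 / 2 > 0" using assms by simp
    ultimately have "1 / (exp \<kappa> - 1) \<le> 1 / (\<kappa>\<^sup>2 / 2)" by (intro frac_le) auto
    then show ?thesis by simp
  qed
  finally have *: "(\<Sum>k\<in>{1..R}. exp (- \<kappa> * real k ^ 6)) \<le> 2 / \<kappa>\<^sup>2" .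
  have "(\<Sum>b\<in>{- int R..int R}. exp (- \<kappa> * real_of_int b ^ 6)) =
     (\<Sum>k\<in>{1..R}. exp (- \<kappa> * real k ^ 6)) + (1 + (\<Sum>k\<in>{1..R}. exp (- \<kappa> * real k ^ 6)))"
    unfolding eq
    by (subst sum.union_disjoint, simp, simp, force, subst sum.union_disjoint)
       (auto simp: sum.reindex inj_on_def)
  also have "\<dots> \<le> 1 + 4 / \<kappa>\<^sup>2" using * by simp
  also have "\<dots> \<le> exp (4 / \<kappa>\<^sup>2)" by (rule exp_ge_add_one_self)
  finally show ?thesis .
qed

section \<open>Spencer's colouring theorem\<close>

text \<open>Jensen's inequality for the exponential, from the tangent line at \<mu>: exp (\<mu> - f
  x) >= 1 + (\<mu> - f x), summed over \<open>A\<close>.\<close>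

lemma exp_avg_le:
  fixes f :: "'a \<Rightarrow> real"
  assumes "finite A" "(\<Sum>x\<in>A. f x) \<le> real (card A) * \<mu>"
  shows "real (card A) * exp (- \<mu>) \<le> (\<Sum>x\<in>A. exp (- f x))"
proof -
  have "real (card A) * exp (- \<mu>) \<le> exp (- \<mu>) * (real (card A) + (real (card A) * \<mu> - (\<Sum>x\<in>A. f x)))"
    using assms by (simp add: algebra_simps)
  also have "\<dots> = (\<Sum>x\<in>A. exp (- \<mu>) * (1 + (\<mu> - f x)))"
    by (simp add: sum_distrib_left[symmetric] sum.distrib sum_subtractf)
  also have "\<dots> \<le> (\<Sum>x\<in>A. exp (- \<mu>) * exp (\<mu> - f x))"
    by (intro sum_mono mult_left_mono exp_ge_add_one_self) auto
  also have "\<dots> = (\<Sum>x\<in>A. exp (- f x))"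
    by (simp flip: exp_add)
  finally show ?thesis .
qed

text \<open>Weighted pigeonhole: if all fibres had fewer than \<open>M\<close> points, grouping the
  sum by fibres would bound it strictly below \<open>M * W\<close>. Small weights on remote labels
  make up for their number.\<close>

lemma exists_large_fibre:
  fixes w :: "'b \<Rightarrow> real" and M :: real
  assumes "finite A" "finite B" "f ` A \<subseteq> B" "\<And>b. b \<in> B \<Longrightarrow> w b \<ge> 0"
    and "(\<Sum>b\<in>B. w b) \<le> W" "W > 0" "M * W \<le> (\<Sum>x\<in>A. w (f x))" "M > 0"
  shows "\<exists>b. M \<le> real (card {x\<in>A. f x = b})"
proof (rule ccontr)
  assume "\<not> ?thesis"
  then have lt: "real (card {x\<in>A. f x = b}) < M" for b by (meson not_le)
  have "(\<Sum>x\<in>A. w (f x)) = (\<Sum>b\<in>B. \<Sum>x\<in>{x\<in>A. f x = b}. w (f x))"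
    using assms by (intro sum.group[symmetric]) auto
  also have "\<dots> = (\<Sum>b\<in>B. real (card {x\<in>A. f x = b}) * w b)"
    by (intro sum.cong refl) simp
  finally have eq: "(\<Sum>x\<in>A. w (f x)) = (\<Sum>b\<in>B. real (card {x\<in>A. f x = b}) * w b)" .
  \<comment> \<open>A label of positive weight is what makes the comparison below strict.\<close>
  have pos: "(\<Sum>x\<in>A. w (f x)) > 0"
    using assms by (meson mult_pos_pos less_le_trans)
  then obtain b0 where b0: "b0 \<in> B" "w b0 > 0"
    using assms(4) unfolding eq by (metis (no_types, lifting) less_eq_real_def mult_zero_right not_less sum_nonpos)
  have "(\<Sum>b\<in>B. real (card {x\<in>A. f x = b}) * w b) < (\<Sum>b\<in>B. M * w b)"
  proof (rule sum_strict_mono_ex1)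
    show "\<exists>b\<in>B. real (card {x\<in>A. f x = b}) * w b < M * w b"
      using b0 lt[of b0] by (intro bexI[of _ b0] mult_strict_right_mono)
  qed (use assms lt in \<open>auto intro!: mult_right_mono less_imp_le[OF lt]\<close>)
  also have "\<dots> = M * (\<Sum>b\<in>B. w b)" by (simp add: sum_distrib_left)
  also have "\<dots> \<le> M * W" using assms by (intro mult_left_mono) auto
  finally show False using assms eq by linarith
qed

text \<open>
  A substitute for the entropy method: Jensen's inequality bounds the average of
  \<open>exp (- \<kappa> \<Sum> b\<^sub>i\<^sup>6)\<close> over all sign patterns from below, where \<open>b\<^sub>i\<close> is the rounded \<open>i\<close>-th form,
  while summing this weight over all integer vectors \<open>b\<close> gives a product of convergent series.
\<close>
lemma large_cell:
  fixes a :: "'i \<Rightarrow> 'a \<Rightarrow> real" and D \<kappa> :: real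
  assumes fin: "finite S" "finite I"
    and a: "\<And>i x. i \<in> I \<Longrightarrow> x \<in> S \<Longrightarrow> \<bar>a i x\<bar> \<le> 1"
    and "D > 0" "\<kappa> > 0"
  shows "\<exists>F \<subseteq> Pow S. (\<forall>T1\<in>F. \<forall>T2\<in>F. \<forall>i\<in>I. \<bar>signed_sum (a i) S T1 - signed_sum (a i) S T2\<bar> \<le> 2 * D) \<and>
     2 ^ card S * exp (- (real (card I) * (15 * \<kappa> * real (card S) ^ 3 / D ^ 6 + 4 / \<kappa>\<^sup>2))) \<le> real (card F)"
proof -
  define n where "n = card S"
  define L where "L = (\<lambda>i T. signed_sum (a i) S T)"
  \<comment> \<open>Rounding at scale \<open>2 * D\<close>: patterns with equal labels have forms at
    distance less than \<open>2 * D\<close>.\<close>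
  define b where "b = (\<lambda>T. \<lambda>i\<in>I. round (L i T / (2 * D)))"
  define R where "R = nat (Max (insert 0 ((\<lambda>(i,T). \<bar>round (L i T / (2 * D))\<bar>) ` (I \<times> Pow S))))"
  define B where "B = PiE I (\<lambda>_. {- int R..int R})"
  define w where "w = (\<lambda>b. \<Prod>i\<in>I. exp (- \<kappa> * real_of_int (b i :: int) ^ 6))"
  define E where "E = real (card I) * (15 * \<kappa> * real n ^ 3 / D ^ 6 + 4 / \<kappa>\<^sup>2)"
  define W where "W = exp (4 / \<kappa>\<^sup>2) ^ card I"
  have R: "\<bar>round (L i T / (2 * D))\<bar> \<le> int R" if "i \<in> I" "T \<in> Pow S" for i T
  proof -
    have "\<bar>round (L i T / (2 * D))\<bar> \<le> Max (insert 0 ((\<lambda>(i,T). \<bar>round (L i T / (2 * D))\<bar>) ` (I \<times> Pow S)))"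
      using that fin by (intro Max_ge) (auto simp: image_iff)
    also have "\<dots> \<le> int R" by (simp add: R_def)
    finally show ?thesis .
  qed
  have bB: "b ` Pow S \<subseteq> B"
  proof safe
    fix T assume "T \<subseteq> S"
    then have "- int R \<le> round (L i T / (2 * D)) \<and> round (L i T / (2 * D)) \<le> int R" if "i \<in> I" for i
      using R[of i T] that by auto
    then show "b T \<in> B" by (auto simp: b_def B_def)
  qed
  have finB: "finite B" using fin by (auto simp: B_def intro!: finite_PiE)
  have "(\<Sum>b\<in>B. w b) = (\<Prod>i\<in>I. \<Sum>k\<in>{- int R..int R}. exp (- \<kappa> * real_of_int k ^ 6))"
    unfolding B_def w_def using fin by (intro prod_sum_PiE[symmetric]) auto
  also have "\<dots> \<le> (\<Prod>i\<in>I. exp (4 / \<kappa>\<^sup>2))"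
    using \<open>\<kappa> > 0\<close> by (intro prod_mono conjI sum_nonneg sum_exp_sixth_power_le) auto
  finally have wW: "(\<Sum>b\<in>B. w b) \<le> W" by (simp add: W_def)
  \<comment> \<open>Rounding gives 0 below 1/2 and otherwise moves a number by at most 1/2, so it at
    most doubles the absolute value; this factor 2 cancels the one in the scale
    \<open>2 * D\<close>.\<close>
  have rnd: "real_of_int (round z) ^ 6 \<le> (2 * z) ^ 6" for z :: real
  proof (cases "round z = 0")
    case False
    have "\<bar>z\<bar> \<ge> 1/2"
    proof (rule ccontr)
      assume "\<not> \<bar>z\<bar> \<ge> 1/2"
      then have "round z = 0" by (intro round_unique') auto
      with False show False by simp
    qed
    then have "\<bar>real_of_int (round z)\<bar> \<le> \<bar>2 * z\<bar>"
      using of_int_round_abs_le[of z] by linarith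
    then have "\<bar>real_of_int (round z)\<bar> ^ 6 \<le> \<bar>2 * z\<bar> ^ 6" by (intro power_mono) auto
    then show ?thesis by (simp add: power_even_abs)
  qed auto
  have mom: "(\<Sum>T\<in>Pow S. real_of_int (b T i) ^ 6) \<le> 2 ^ n * (15 * real n ^ 3 / D ^ 6)" if i: "i \<in> I" for i
  proof -
    have "(\<Sum>T\<in>Pow S. real_of_int (b T i) ^ 6) \<le> (\<Sum>T\<in>Pow S. L i T ^ 6 / D ^ 6)"
    proof (rule sum_mono)
      fix T
      show "real_of_int (b T i) ^ 6 \<le> L i T ^ 6 / D ^ 6"
        using rnd[of "L i T / (2 * D)"] i by (simp add: b_def power_divide)
    qed
    also have "\<dots> = (\<Sum>T\<in>Pow S. L i T ^ 6) / D ^ 6"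
      by (simp add: sum_divide_distrib)
    also have "\<dots> \<le> 15 * real n ^ 3 * 2 ^ n / D ^ 6"
      unfolding L_def n_def using i a fin \<open>D > 0\<close> by (intro divide_right_mono sixth_moment) auto
    finally show ?thesis by (simp add: mult_ac)
  qed
  have "(\<Sum>T\<in>Pow S. \<Sum>i\<in>I. \<kappa> * real_of_int (b T i) ^ 6) = (\<Sum>i\<in>I. \<kappa> * (\<Sum>T\<in>Pow S. real_of_int (b T i) ^ 6))"
    by (subst sum.swap) (simp add: sum_distrib_left)
  also have "\<dots> \<le> (\<Sum>i\<in>I. \<kappa> * (2 ^ n * (15 * real n ^ 3 / D ^ 6)))"
    using \<open>\<kappa> > 0\<close> by (intro sum_mono mult_left_mono mom) auto
  also have "\<dots> = real (card (Pow S)) * (real (card I) * (15 * \<kappa> * real n ^ 3 / D ^ 6))"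
    using fin by (simp add: card_Pow n_def)
  finally have "real (card (Pow S)) * exp (- (real (card I) * (15 * \<kappa> * real n ^ 3 / D ^ 6))) \<le>
      (\<Sum>T\<in>Pow S. exp (- (\<Sum>i\<in>I. \<kappa> * real_of_int (b T i) ^ 6)))"
    using fin by (intro exp_avg_le) auto
  also have "\<dots> = (\<Sum>T\<in>Pow S. w (b T))"
    using fin by (simp add: w_def exp_sum sum_negf flip: exp_sum)
  finally have low: "2 ^ n * exp (- (real (card I) * (15 * \<kappa> * real n ^ 3 / D ^ 6))) \<le> (\<Sum>T\<in>Pow S. w (b T))"
    using fin by (simp add: card_Pow n_def)
  have "2 ^ n * exp (- E) * W = 2 ^ n * exp (- (real (card I) * (15 * \<kappa> * real n ^ 3 / D ^ 6)))"
    by (simp add: E_def W_def algebra_simps flip: exp_of_nat_mult exp_add)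
  note low[folded this]
  then have "\<exists>v. 2 ^ n * exp (- E) \<le> real (card {T\<in>Pow S. b T = v})"
    using fin finB bB wW by (intro exists_large_fibre[where B = B and w = w and W = W])
      (simp_all add: w_def W_def prod_nonneg)
  then obtain v where v: "2 ^ n * exp (- E) \<le> real (card {T\<in>Pow S. b T = v})" ..
  show ?thesis
  proof (intro exI[of _ "{T\<in>Pow S. b T = v}"] conjI ballI)
    fix T1 T2 i assume T: "T1 \<in> {T\<in>Pow S. b T = v}" "T2 \<in> {T\<in>Pow S. b T = v}" and i: "i \<in> I"
    then have "b T1 i = b T2 i" by simp
    then have "round (L i T1 / (2 * D)) = round (L i T2 / (2 * D))" using i by (simp add: b_def)
    then have "\<bar>L i T1 / (2 * D) - L i T2 / (2 * D)\<bar> < 1" by (rule round_eq_imp_diff_1)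
    then have "\<bar>L i T1 - L i T2\<bar> / (2 * D) < 1"
      using \<open>D > 0\<close> by (simp add: abs_divide flip: diff_divide_distrib)
    then show "\<bar>signed_sum (a i) S T1 - signed_sum (a i) S T2\<bar> \<le> 2 * D"
      using \<open>D > 0\<close> by (simp add: L_def field_simps)
  qed (use v in \<open>auto simp: E_def n_def\<close>)
qed

text \<open>Chernoff's method: with weight \<open>(1/3) ^ card D\<close> the whole power set weighs
  \<open>(4/3) ^ n\<close>, and 1/3 is the optimal ratio for sets of a quarter of the points. The
  fourth power avoids fractional exponents, and (4/3)^4 * 3 = 256/27.\<close>

lemma card_small_subsets_power4:
  assumes "finite S" "card S > 0"
  shows "real (card {D\<in>Pow S. 4 * card D < card S}) ^ 4 \<le> (256 / 27) ^ card S"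
proof -
  define n where "n = card S"
  define q where "q = (n - 1) div 4"
  let ?B = "{D\<in>Pow S. 4 * card D < card S}"
  have "real (card ?B) * (1/3) ^ q = (\<Sum>D\<in>?B. (1/3) ^ q)" by simp
  also have "\<dots> \<le> (\<Sum>D\<in>?B. (1/3::real) ^ card D)"
    by (intro sum_mono power_decreasing) (auto simp: q_def n_def)
  also have "\<dots> \<le> (\<Sum>D\<in>Pow S. (1/3::real) ^ card D)"
    using assms by (intro sum_mono2) auto
  also have "\<dots> = (4/3) ^ n"
    using prod_add[OF assms(1), of "\<lambda>_. 1/3::real" "\<lambda>_. 1"] by (simp add: n_def)
  finally have "real (card ?B) * (1/3) ^ q \<le> (4/3) ^ n" .
  then have "real (card ?B) \<le> (4/3) ^ n * 3 ^ q"
    by (simp add: field_simps)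
  then have "real (card ?B) ^ 4 \<le> ((4/3) ^ n * 3 ^ q) ^ 4"
    by (intro power_mono) auto
  also have "\<dots> = (256/81) ^ n * 3 ^ (q * 4)"
  proof -
    have "((4/3) ^ n :: real) ^ 4 = ((4/3) ^ 4) ^ n" by (metis power_mult mult.commute)
    also have "\<dots> = (256/81) ^ n" by (simp add: power_divide)
    finally show ?thesis by (simp add: power_mult_distrib power_mult)
  qed
  also have "\<dots> \<le> (256/81) ^ n * 3 ^ n"
    by (intro mult_left_mono power_increasing) (auto simp: q_def)
  also have "\<dots> = (256 / 27) ^ n"
    by (simp flip: power_mult_distrib)
  finally show ?thesis by (simp add: n_def)
qed

text \<open>If all pairs were close, the injective map taking a set to its symmetric difference with
  a fixed \<open>T0\<close> in \<open>F\<close> would embed \<open>F\<close> into the family of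
  small sets.\<close>

lemma exists_distant_pair:
  assumes "finite S" "F \<subseteq> Pow S" "card {D\<in>Pow S. 4 * card D < card S} < card F"
  shows "\<exists>T1\<in>F. \<exists>T2\<in>F. card S \<le> 4 * card (sym_diff T1 T2)"
proof (rule ccontr)
  assume "\<not> ?thesis"
  then have lt: "4 * card (sym_diff T1 T2) < card S" if "T1 \<in> F" "T2 \<in> F" for T1 T2
    using that by (meson not_le)
  obtain T0 where T0: "T0 \<in> F" using assms(3) by (metis card.empty equals0I less_nat_zero_code)
  have "card F \<le> card {D\<in>Pow S. 4 * card D < card S}"
    by (rule card_inj_on_le[where f = "sym_diff T0"]) (use lt T0 assms in \<open>auto simp: inj_on_def\<close>)
  with assms(3) show False by simp
qed

text \<open>\<open>P\<close> is the set of points where two patterns of one cell differ, and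
  \<open>Q\<close> holds those with sign plus. The difference of the patterns is twice this partial
  colouring, so the cell width \<open>2 * D\<close> gives discrepancy \<open>D\<close>.\<close>

lemma partial_colouring:
  fixes a :: "'i \<Rightarrow> 'a \<Rightarrow> real"
  assumes fin: "finite S" "finite I" and ne: "S \<noteq> {}" "I \<noteq> {}"
    and a: "\<And>i x. i \<in> I \<Longrightarrow> x \<in> S \<Longrightarrow> \<bar>a i x\<bar> \<le> 1"
  shows "\<exists>P\<subseteq>S. \<exists>Q\<subseteq>P. card S \<le> 4 * card P \<and>
     (\<forall>i\<in>I. \<bar>signed_sum (a i) P Q\<bar> \<le> 4 * sqrt (sqrt (real (card I) * real (card S))))"
proof -
  define n where "n = card S"
  define u where "u = sqrt (real (card I))"
  define v where "v = sqrt (real (card S))"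
  define D where "D = 4 * sqrt (u * v)"
  \<comment> \<open>With this choice both terms of the exponent in \<open>large_cell\<close> become multiples of \<open>card S\<close>.\<close>
  define \<kappa> where "\<kappa> = 8 * u / v"
  have n: "n > 0" using fin ne by (simp add: n_def card_gt_0_iff)
  have uv: "u > 0" "v > 0" using fin ne by (auto simp: u_def v_def card_gt_0_iff)
  have u2: "real (card I) = u ^ 2" and v2: "real (card S) = v ^ 2" by (auto simp: u_def v_def)
  have D: "D > 0" and \<kappa>: "\<kappa> > 0" using uv by (auto simp: D_def \<kappa>_def)
  have "D ^ 6 = (D ^ 2) ^ 3" by (simp flip: power_mult)
  also have "D ^ 2 = 16 * (u * v)" using uv by (simp add: D_def power_mult_distrib)
  finally have D6: "D ^ 6 = 4096 * u ^ 3 * v ^ 3" by (simp add: power_mult_distrib)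
  have "real (card I) * (15 * \<kappa> * real (card S) ^ 3 / D ^ 6 + 4 / \<kappa>\<^sup>2) = (120 / 4096 + 1 / 16) * v ^ 2"
    using uv unfolding u2 v2 D6 \<kappa>_def by (simp add: field_simps power2_eq_square power3_eq_cube)
  also have "\<dots> \<le> real n / 8" unfolding v2[symmetric] n_def[symmetric] by simp
  finally have expo: "real (card I) * (15 * \<kappa> * real (card S) ^ 3 / D ^ 6 + 4 / \<kappa>\<^sup>2) \<le> real n / 8" .
  obtain F where F: "F \<subseteq> Pow S"
    "\<forall>T1\<in>F. \<forall>T2\<in>F. \<forall>i\<in>I. \<bar>signed_sum (a i) S T1 - signed_sum (a i) S T2\<bar> \<le> 2 * D"
    "2 ^ n * exp (- (real (card I) * (15 * \<kappa> * real (card S) ^ 3 / D ^ 6 + 4 / \<kappa>\<^sup>2))) \<le> real (card F)"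
    unfolding n_def
    by (rule exE[OF large_cell[of S I a D \<kappa>, OF fin _ D \<kappa>]]) (use a that in blast)+
  \<comment> \<open>The number 225/128 = 2 * (15/16)^2 is a rational lower bound for 2 exp (-1/8),
    which in turn bounds the growth rate of the cell from below.\<close>
  have "(225/128) ^ n = 2 ^ n * ((15/16) ^ 2 :: real) ^ n"
    by (subst power_mult_distrib[symmetric]) (simp add: power2_eq_square)
  also have "\<dots> \<le> 2 ^ n * exp (- (1/8)) ^ n"
  proof -
    have "15/16 \<le> exp (- (1/16) :: real)" using exp_ge_add_one_self[of "- (1/16)"] by simp
    then have "(15/16) ^ 2 \<le> exp (- (1/16) :: real) ^ 2" by (intro power_mono) auto
    also have "\<dots> = exp (- (1/8))" by (simp flip: exp_of_nat_mult)
    finally show ?thesis by (intro mult_left_mono power_mono) auto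
  qed
  also have "\<dots> = 2 ^ n * exp (- (real n / 8))"
    by (simp flip: exp_of_nat_mult)
  also have "\<dots> \<le> real (card F)"
    using expo by (intro order_trans[OF _ F(3)] mult_left_mono) auto
  finally have cF: "(225/128) ^ n \<le> real (card F)" .
  have "real (card {D\<in>Pow S. 4 * card D < card S}) ^ 4 \<le> (256 / 27) ^ n"
    unfolding n_def using fin n by (intro card_small_subsets_power4) (auto simp: n_def)
  \<comment> \<open>Here (225/128)^4 is about 9.55 and 256/27 about 9.48, so the cell outnumbers the
    small sets.\<close>
  also have "\<dots> < ((225/128) ^ 4) ^ n"
    using n by (intro power_strict_mono) (auto simp: power_divide)
  also have "\<dots> = ((225/128) ^ n) ^ 4" by (metis power_mult mult.commute)
  also have "\<dots> \<le> real (card F) ^ 4" using cF by (intro power_mono) auto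
  finally have "card {D\<in>Pow S. 4 * card D < card S} < card F"
    using power_less_imp_less_base[of "real (card {D\<in>Pow S. 4 * card D < card S})" 4 "real (card F)"] by simp
  then obtain T1 T2 where T: "T1 \<in> F" "T2 \<in> F" "card S \<le> 4 * card (sym_diff T1 T2)"
    using exists_distant_pair[OF fin(1) F(1)] by blast
  have sub: "T1 \<subseteq> S" "T2 \<subseteq> S" using T F by auto
  have eq: "signed_sum f S T1 - signed_sum f S T2 = 2 * signed_sum f (sym_diff T1 T2) (T1 - T2)" for f
  proof -
    have "signed_sum f S T1 - signed_sum f S T2 =
        (\<Sum>x\<in>S. (if x \<in> T1 then f x else - f x) - (if x \<in> T2 then f x else - f x))"
      by (simp add: signed_sum_def sum_subtractf)
    also have "\<dots> = (\<Sum>x\<in>sym_diff T1 T2. 2 * (if x \<in> T1 - T2 then f x else - f x))"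
      using fin sub by (intro sum.mono_neutral_cong_right) auto
    finally show ?thesis by (simp add: signed_sum_def sum_distrib_left)
  qed
  have D_eq: "D = 4 * sqrt (sqrt (real (card I) * real (card S)))"
    by (simp add: D_def u_def v_def real_sqrt_mult)
  have "\<bar>signed_sum (a i) (sym_diff T1 T2) (T1 - T2)\<bar> \<le> 4 * sqrt (sqrt (real (card I) * real (card S)))"
    if "i \<in> I" for i
  proof -
    have "\<bar>signed_sum (a i) S T1 - signed_sum (a i) S T2\<bar> \<le> 2 * D" using F(2) T that by blast
    then show ?thesis unfolding eq D_eq[symmetric] by simp
  qed
  moreover have "sym_diff T1 T2 \<subseteq> S" "T1 - T2 \<subseteq> sym_diff T1 T2" using sub by auto
  ultimately show ?thesis using T(3) by blast
qed

text \<open>At least a quarter of the points is coloured at each stage, and the rest is handled by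
  induction. As 3/4 <= (14/15)^4, the constant 60 reproduces itself: 4 + 60 * 14/15 = 60.\<close>

theorem spencer_colouring:
  fixes a :: "'i \<Rightarrow> 'a \<Rightarrow> real"
  assumes "finite S" "finite I" "I \<noteq> {}"
    and "\<And>i x. i \<in> I \<Longrightarrow> x \<in> S \<Longrightarrow> \<bar>a i x\<bar> \<le> 1"
  shows "\<exists>T\<subseteq>S. \<forall>i\<in>I. \<bar>signed_sum (a i) S T\<bar> \<le> 60 * sqrt (sqrt (real (card I) * real (card S)))"
  using assms
proof (induction "card S" arbitrary: S rule: less_induct)
  case less
  show ?case
  proof (cases "S = {}")
    case True
    then show ?thesis by (auto simp: signed_sum_def)
  next
    case False
    let ?X = "real (card I) * real (card S)"
    obtain P Q where PQ: "P \<subseteq> S" "Q \<subseteq> P" "card S \<le> 4 * card P"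
      "\<And>i. i \<in> I \<Longrightarrow> \<bar>signed_sum (a i) P Q\<bar> \<le> 4 * sqrt (sqrt ?X)"
      using partial_colouring[of S I a] less.prems False by blast
    have finP: "finite P" using PQ less.prems finite_subset by blast
    have cS: "card S > 0" using False less.prems by (simp add: card_gt_0_iff)
    have cd: "card (S - P) = card S - card P" using PQ finP by (simp add: card_Diff_subset)
    have "card (S - P) < card S" using cd PQ(3) cS by simp
    then obtain T where T: "T \<subseteq> S - P"
      "\<And>i. i \<in> I \<Longrightarrow> \<bar>signed_sum (a i) (S - P) T\<bar> \<le> 60 * sqrt (sqrt (real (card I) * real (card (S - P))))"
      using less.hyps[of "S - P"] less.prems by (metis DiffD1 finite_Diff)
    have "real (card (S - P)) \<le> (3/4) * real (card S)" using cd PQ(3) by simp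
    also have "\<dots> \<le> (14/15) ^ 4 * real (card S)" by (intro mult_right_mono) (auto simp: power_divide)
    finally have "real (card I) * real (card (S - P)) \<le> real (card I) * ((14/15) ^ 4 * real (card S))"
      by (intro mult_left_mono) auto
    then have "sqrt (sqrt (real (card I) * real (card (S - P)))) \<le> sqrt (sqrt ((14/15) ^ 4 * ?X))"
      by (simp add: mult_ac)
    also have "\<dots> = 14/15 * sqrt (sqrt ?X)"
    proof -
      have "sqrt ((14/15) ^ 4) = (14/15 :: real) ^ 2"
        by (intro real_sqrt_unique) (simp_all flip: power_mult)
      then have "sqrt (sqrt ((14/15) ^ 4)) = (14/15 :: real)" by simp
      then show ?thesis by (simp add: real_sqrt_mult)
    qed
    finally have red: "sqrt (sqrt (real (card I) * real (card (S - P)))) \<le> 14/15 * sqrt (sqrt ?X)" .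
    show ?thesis
    proof (intro exI[of _ "Q \<union> T"] conjI ballI)
      fix i assume i: "i \<in> I"
      have "signed_sum (a i) S (Q \<union> T) = signed_sum (a i) P (Q \<union> T) + signed_sum (a i) (S - P) (Q \<union> T)"
        unfolding signed_sum_def by (subst sum.subset_diff[OF PQ(1) less.prems(1)]) (rule add.commute)
      also have "signed_sum (a i) P (Q \<union> T) = signed_sum (a i) P Q"
        unfolding signed_sum_def using T by (intro sum.cong) auto
      also have "signed_sum (a i) (S - P) (Q \<union> T) = signed_sum (a i) (S - P) T"
        unfolding signed_sum_def using PQ by (intro sum.cong) auto
      finally show "\<bar>signed_sum (a i) S (Q \<union> T)\<bar> \<le> 60 * sqrt (sqrt ?X)"
        using PQ(4)[OF i] T(2)[OF i] red by linarith
    qed (use PQ T in auto)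
  qed
qed

section \<open>Rounding with small Fourier error\<close>

text \<open>The binary digits of \<open>g\<close> are removed from the last one upwards, colouring the odd values each time.\<close>
lemma dyadic_rounding:
  fixes a :: "'i \<Rightarrow> 'a \<Rightarrow> real" and g :: "'a \<Rightarrow> nat"
  assumes fin: "finite U" "finite I" "I \<noteq> {}"
    and a: "\<And>i x. i \<in> I \<Longrightarrow> x \<in> U \<Longrightarrow> \<bar>a i x\<bar> \<le> 1"
    and K: "K = 60 * sqrt (sqrt (real (card I) * real (card U)))"
    and g: "\<And>x. x \<in> U \<Longrightarrow> g x \<le> 2 ^ t"
  shows "\<exists>A\<subseteq>U. \<forall>i\<in>I. \<bar>(\<Sum>x\<in>A. a i x) - (\<Sum>x\<in>U. real (g x) / 2 ^ t * a i x)\<bar> \<le> K * (1 - 1 / 2 ^ t)"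
  using g
proof (induction t arbitrary: g)
  case 0
  have "(\<Sum>x\<in>{x\<in>U. g x = 1}. a i x) = (\<Sum>x\<in>U. real (g x) * a i x)" for i
  proof (rule sum.mono_neutral_cong_left)
    show "\<forall>x\<in>U - {x\<in>U. g x = 1}. real (g x) * a i x = 0"
      using 0 by (fastforce simp: le_Suc_eq)
  qed (use fin in auto)
  then show ?case by (intro exI[of _ "{x\<in>U. g x = 1}"]) auto
next
  case (Suc t)
  \<comment> \<open>Only odd numerators have to move, by one up or down as the colouring says,
    before all can be halved.\<close>
  define S where "S = {x\<in>U. odd (g x)}"
  have S: "finite S" "S \<subseteq> U" using fin by (auto simp: S_def)
  obtain Q where Q: "Q \<subseteq> S"
    "\<And>i. i \<in> I \<Longrightarrow> \<bar>signed_sum (a i) S Q\<bar> \<le> 60 * sqrt (sqrt (real (card I) * real (card S)))"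
    using spencer_colouring[of S I a] S fin a by (metis subsetD)
  have "sqrt (sqrt (real (card I) * real (card S))) \<le> sqrt (sqrt (real (card I) * real (card U)))"
    using card_mono[OF fin(1) S(2)] by (simp add: mult_left_mono)
  then have QK: "\<bar>signed_sum (a i) S Q\<bar> \<le> K" if "i \<in> I" for i
    using Q(2)[OF that] unfolding K by linarith
  define h where "h = (\<lambda>x. if x \<in> Q then (g x + 1) div 2 else g x div 2)"
  have "h x \<le> 2 ^ t" if "x \<in> U" for x
    using Suc.prems[OF that] Q(1) by (auto simp: h_def S_def elim!: oddE)
  then obtain A where A: "A \<subseteq> U"
    "\<And>i. i \<in> I \<Longrightarrow> \<bar>(\<Sum>x\<in>A. a i x) - (\<Sum>x\<in>U. real (h x) / 2 ^ t * a i x)\<bar> \<le> K * (1 - 1 / 2 ^ t)"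
    using Suc.IH[of h] by blast
  have h2: "2 * real (h x) = real (g x) + (if x \<in> S then (if x \<in> Q then 1 else -1) else 0)" if "x \<in> U" for x
    using that Q(1) by (auto simp: h_def S_def real_of_nat_div elim!: oddE evenE)
  have diff: "(\<Sum>x\<in>U. real (h x) / 2 ^ t * a i x) - (\<Sum>x\<in>U. real (g x) / 2 ^ Suc t * a i x) =
      signed_sum (a i) S Q / 2 ^ Suc t" for i
  proof -
    have "(\<Sum>x\<in>U. real (h x) / 2 ^ t * a i x) - (\<Sum>x\<in>U. real (g x) / 2 ^ Suc t * a i x) =
        (\<Sum>x\<in>U. (2 * real (h x) - real (g x)) * a i x / 2 ^ Suc t)"
      by (simp add: sum_subtractf[symmetric] diff_divide_distrib algebra_simps)
    also have "\<dots> = (\<Sum>x\<in>S. (if x \<in> Q then a i x else - a i x) / 2 ^ Suc t)"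
      using S fin h2 by (intro sum.mono_neutral_cong_right) auto
    finally show ?thesis by (simp add: signed_sum_def sum_divide_distrib)
  qed
  show ?case
  proof (intro exI[of _ A] conjI ballI)
    fix i assume i: "i \<in> I"
    have "\<bar>signed_sum (a i) S Q / 2 ^ Suc t\<bar> \<le> K / 2 ^ Suc t"
      using QK[OF i] by (simp add: abs_divide divide_right_mono)
    \<comment> \<open>The stage with denominator 2^(t+1) costs \<open>K / 2 ^ Suc t\<close>, so the
      total over all digits is a geometric sum below \<open>K\<close>.\<close>
    moreover have "K * (1 - 1 / 2 ^ Suc t) = K * (1 - 1 / 2 ^ t) + K / 2 ^ Suc t"
      by (simp add: field_simps)
    ultimately show "\<bar>(\<Sum>x\<in>A. a i x) - (\<Sum>x\<in>U. real (g x) / 2 ^ Suc t * a i x)\<bar> \<le> K * (1 - 1 / 2 ^ Suc t)"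
      using A(2)[OF i] diff[of i] by linarith
  qed (use A in auto)
qed

text \<open>Truncating \<open>f\<close> to \<open>t = card U\<close> binary digits costs at most
  2^(-t) per point, hence at most t / 2^t <= 1 in each form. This is the summand 1 beside the error
  of the digit rounding.\<close>

lemma simultaneous_rounding:
  fixes a :: "'i \<Rightarrow> 'a \<Rightarrow> real" and f :: "'a \<Rightarrow> real"
  assumes fin: "finite U" "finite I" "I \<noteq> {}"
    and a: "\<And>i x. i \<in> I \<Longrightarrow> x \<in> U \<Longrightarrow> \<bar>a i x\<bar> \<le> 1"
    and f: "\<And>x. x \<in> U \<Longrightarrow> 0 \<le> f x \<and> f x \<le> 1"
  shows "\<exists>A\<subseteq>U. \<forall>i\<in>I. \<bar>(\<Sum>x\<in>A. a i x) - (\<Sum>x\<in>U. f x * a i x)\<bar>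
      \<le> 60 * sqrt (sqrt (real (card I) * real (card U))) + 1"
proof -
  define t where "t = card U"
  define K where "K = 60 * sqrt (sqrt (real (card I) * real (card U)))"
  define g where "g = (\<lambda>x. nat \<lfloor>f x * 2 ^ t\<rfloor>)"
  have g: "real (g x) \<le> f x * 2 ^ t" "f x * 2 ^ t \<le> real (g x) + 1" if "x \<in> U" for x
    using f[OF that] by (simp_all add: g_def)
  have "g x \<le> 2 ^ t" if "x \<in> U" for x
  proof -
    have "f x * 2 ^ t \<le> 1 * 2 ^ t" using f[OF that] by (intro mult_right_mono) auto
    with g(1)[OF that] have "real (g x) \<le> 1 * 2 ^ t" by linarith
    then show ?thesis by simp
  qed
  then have "\<exists>A\<subseteq>U. \<forall>i\<in>I. \<bar>(\<Sum>x\<in>A. a i x) - (\<Sum>x\<in>U. real (g x) / 2 ^ t * a i x)\<bar> \<le> K * (1 - 1 / 2 ^ t)"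
    by (intro dyadic_rounding[OF fin] a K_def)
  then obtain A where A: "A \<subseteq> U"
    "\<And>i. i \<in> I \<Longrightarrow> \<bar>(\<Sum>x\<in>A. a i x) - (\<Sum>x\<in>U. real (g x) / 2 ^ t * a i x)\<bar> \<le> K * (1 - 1 / 2 ^ t)"
    by blast
  have "\<bar>(\<Sum>x\<in>U. real (g x) / 2 ^ t * a i x) - (\<Sum>x\<in>U. f x * a i x)\<bar> \<le> 1" if i: "i \<in> I" for i
  proof -
    have "\<bar>(\<Sum>x\<in>U. real (g x) / 2 ^ t * a i x) - (\<Sum>x\<in>U. f x * a i x)\<bar> =
        \<bar>\<Sum>x\<in>U. (real (g x) / 2 ^ t - f x) * a i x\<bar>"
      by (simp add: sum_subtractf[symmetric] left_diff_distrib)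
    also have "\<dots> \<le> (\<Sum>x\<in>U. 1 / 2 ^ t)"
    proof (intro order_trans[OF sum_abs] sum_mono)
      fix x assume x: "x \<in> U"
      have "\<bar>real (g x) - f x * 2 ^ t\<bar> \<le> 1" using g[OF x] by linarith
      then have "\<bar>(real (g x) - f x * 2 ^ t) / 2 ^ t\<bar> \<le> 1 / 2 ^ t"
        by (simp add: abs_divide divide_right_mono)
      then have "\<bar>real (g x) / 2 ^ t - f x\<bar> \<le> 1 / 2 ^ t" by (simp add: diff_divide_distrib)
      from mult_mono[OF this a[OF i x]] show "\<bar>(real (g x) / 2 ^ t - f x) * a i x\<bar> \<le> 1 / 2 ^ t"
        by (simp add: abs_mult)
    qed
    also have "\<dots> = real t / 2 ^ t" by (simp add: t_def)
    also have "\<dots> \<le> 1" using of_nat_less_two_power[of t, where 'a = real] by simp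
    finally show ?thesis .
  qed
  moreover have "K * (1 - 1 / 2 ^ t) \<le> K * 1" by (intro mult_left_mono) (auto simp: K_def)
  ultimately have "\<bar>(\<Sum>x\<in>A. a i x) - (\<Sum>x\<in>U. f x * a i x)\<bar> \<le> K + 1" if "i \<in> I" for i
    using A(2)[OF that] that by fastforce
  then show ?thesis using A(1) unfolding K_def by blast
qed

lemma exists_subset_adjust_card:
  assumes "finite U" "A \<subseteq> U" "M \<le> card U"
  shows "\<exists>A'\<subseteq>U. card A' = M \<and> real (card (sym_diff A A')) = \<bar>real (card A) - real M\<bar>"
proof (cases "M \<le> card A")
  case True
  then obtain A' where A': "A' \<subseteq> A" "card A' = M" by (meson obtain_subset_with_card_n)
  then have "card (sym_diff A A') = card A - M"
    using assms by (metis Diff_eq_empty_iff card_Diff_subset finite_subset sup_bot.right_neutral)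
  then show ?thesis using True A' assms by (intro exI[of _ A']) auto
next
  case False
  have finA: "finite A" using assms finite_subset by blast
  have "M - card A \<le> card (U - A)" using assms finA by (simp add: card_Diff_subset)
  then obtain E where E: "E \<subseteq> U - A" "card E = M - card A" by (meson obtain_subset_with_card_n)
  have finE: "finite E" using E assms by (meson finite_Diff finite_subset)
  have "sym_diff A (A \<union> E) = E" using E by auto
  moreover have "card (A \<union> E) = M" using E False finA finE by (subst card_Un_disjoint) auto
  ultimately show ?thesis using False E assms by (intro exI[of _ "A \<union> E"]) auto
qed

section \<open>Rounding weights on the cyclic group\<close>

lemma card_ZN [simp]: "card (ZN N) = N"
  and finite_ZN [simp]: "finite (ZN N)"
  by (simp_all add: ZN_def)

text \<open>Cosines and sines at all \<open>r\<close> are 2 N forms on N points, so the rounding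
  error is at most 60 * 2^(1/4) * sqrt N + 1 <= 73 sqrt N. Real and imaginary part together cost 146
  sqrt N, and correcting the cardinality 73 sqrt N more.\<close>

theorem fourier_rounding:
  fixes f :: "int \<Rightarrow> real"
  assumes N: "N > 0"
    and f: "\<And>x. x \<in> ZN N \<Longrightarrow> 0 \<le> f x \<and> f x \<le> 1"
    and M: "(\<Sum>x\<in>ZN N. f x) = real M"
  shows "\<exists>A\<subseteq>ZN N. card A = M \<and> (\<forall>r\<in>ZN N.
      cmod (fourier_ind N A r - (\<Sum>x\<in>ZN N. of_real (f x) * cis (2 * pi * of_int x * of_int r / of_nat N)))
        \<le> 220 * sqrt (real N))"
proof -
  define \<theta> where "\<theta> = (\<lambda>(x::int) (r::int). 2 * pi * of_int x * of_int r / real N)"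
  define I where "I = ZN N \<times> (UNIV :: bool set)"
  define a where "a = (\<lambda>(r, b) x. if b then cos (\<theta> x r) else sin (\<theta> x r))"
  have zero: "0 \<in> ZN N" using N by (simp add: ZN_def)
  have I: "finite I" "I \<noteq> {}" "card I = N * 2"
    using zero by (auto simp: I_def card_cartesian_product)
  have ai: "\<bar>a i x\<bar> \<le> 1" for i x by (cases i) (simp add: a_def)
  obtain A where A: "A \<subseteq> ZN N"
    "\<And>i. i \<in> I \<Longrightarrow> \<bar>(\<Sum>x\<in>A. a i x) - (\<Sum>x\<in>ZN N. f x * a i x)\<bar>
       \<le> 60 * sqrt (sqrt (real (card I) * real (card (ZN N)))) + 1"
    by (rule exE[OF simultaneous_rounding[of "ZN N" I a f, OF finite_ZN I(1,2) ai f]]) (use that in blast)+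
  have finA: "finite A" by (rule finite_subset[OF A(1) finite_ZN])
  have sN: "sqrt (real N) \<ge> 1" using N by simp
  have "60 * sqrt (sqrt (real (card I) * real (card (ZN N)))) = 60 * (sqrt (sqrt 2) * sqrt (real N))"
    using I(3) by (simp add: real_sqrt_mult)
  also have "\<dots> \<le> 60 * (1.2 * sqrt (real N))"
  proof -
    have "sqrt 2 \<le> 1.2 ^ 2" by (rule real_le_lsqrt) (simp_all add: power_divide)
    then have "sqrt (sqrt 2) \<le> 1.2" by (rule real_le_lsqrt[rotated]) simp_all
    then show ?thesis by (intro mult_left_mono mult_right_mono) auto
  qed
  finally have bound: "60 * sqrt (sqrt (real (card I) * real (card (ZN N)))) + 1 \<le> 73 * sqrt (real N)"
    using sN by linarith
  let ?F = "\<lambda>r. \<Sum>x\<in>ZN N. of_real (f x) * cis (\<theta> x r)"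
  have A_close: "cmod (fourier_ind N A r - ?F r) \<le> 146 * sqrt (real N)" if "r \<in> ZN N" for r
  proof -
    have "\<bar>Re (fourier_ind N A r - ?F r)\<bar> \<le> 73 * sqrt (real N)"
      using A(2)[of "(r, True)"] that bound by (simp add: I_def a_def fourier_ind_def \<theta>_def)
    moreover have "\<bar>Im (fourier_ind N A r - ?F r)\<bar> \<le> 73 * sqrt (real N)"
      using A(2)[of "(r, False)"] that bound by (simp add: I_def a_def fourier_ind_def \<theta>_def)
    ultimately show ?thesis using cmod_le[of "fourier_ind N A r - ?F r"] by linarith
  qed
  \<comment> \<open>The cosine form at frequency 0 counts points, so the rounding controls the
    cardinality as well.\<close>
  have "\<bar>real (card A) - real M\<bar> \<le> 73 * sqrt (real N)"
    using A(2)[of "(0, True)"] zero bound M by (simp add: I_def a_def \<theta>_def)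
  moreover have "real M \<le> real N"
    using f sum_bounded_above[of "ZN N" f 1] unfolding M[symmetric] by simp
  ultimately obtain A' where A': "A' \<subseteq> ZN N" "card A' = M" "real (card (sym_diff A A')) \<le> 73 * sqrt (real N)"
    using exists_subset_adjust_card[of "ZN N" A M] A(1) by auto
  have finA': "finite A'" by (rule finite_subset[OF A'(1) finite_ZN])
  have "cmod (fourier_ind N A' r - fourier_ind N A r) \<le> real (card (sym_diff A A'))" for r
  proof -
    have "fourier_ind N A' r - fourier_ind N A r =
        (\<Sum>x\<in>A' - A. cis (\<theta> x r)) - (\<Sum>x\<in>A - A'. cis (\<theta> x r))"
      unfolding fourier_ind_def \<theta>_def using finA finA'
      by (simp add: sum_diff Int_commute sum.Int_Diff[of A' _ A] sum.Int_Diff[of A _ A'])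
    also have "cmod \<dots> \<le> real (card (A' - A)) + real (card (A - A'))"
      by (intro order_trans[OF norm_triangle_ineq4] add_mono sum_norm_bound[where K = 1, simplified]) auto
    also have "\<dots> = real (card (sym_diff A A'))"
      using finA finA' by (subst card_Un_disjoint) auto
    finally show ?thesis .
  qed
  then have "cmod (fourier_ind N A' r - ?F r) \<le> 220 * sqrt (real N)" if "r \<in> ZN N" for r
    using A_close[OF that] A'(3) norm_triangle_ineq[of "fourier_ind N A' r - fourier_ind N A r" "fourier_ind N A r - ?F r"] sN
    by (smt (verit) diff_add_cancel add_diff_eq)
  then show ?thesis using A' unfolding \<theta>_def by blast
qed

section \<open>Riesz products over a dissociated set\<close>

lemma character_orthogonality:
  fixes k :: int
  assumes "N > 0"
  shows "(\<Sum>x\<in>ZN N. cis (2 * pi * of_int x * of_int k / of_nat N)) = (if int N dvd k then of_nat N else 0)"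
proof -
  define z where "z = cis (2 * pi * of_int k / of_nat N)"
  have zN: "z ^ N = 1"
    using assms by (simp add: z_def DeMoivre)
  have "z = 1 \<longleftrightarrow> (\<exists>n. 2 * pi * of_int k / real N = of_int n * (2 * pi))"
    unfolding z_def cis_eq_1_iff ..
  also have "\<dots> \<longleftrightarrow> (\<exists>n. of_int k = (of_int (int N * n) :: real))"
    using assms by (intro ex_cong1) (auto simp: field_simps)
  finally have z1: "z = 1 \<longleftrightarrow> int N dvd k"
    unfolding of_int_eq_iff dvd_def .
  have "ZN N = int ` {..<N}"
    by (auto simp: ZN_def image_iff) (metis lessThan_iff nat_less_iff int_nat_eq)
  then have "(\<Sum>x\<in>ZN N. cis (2 * pi * of_int x * of_int k / of_nat N)) = (\<Sum>n<N. z ^ n)"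
    by (simp add: sum.reindex z_def DeMoivre mult_ac)
  also have "\<dots> = (if z = 1 then of_nat N else 0)"
    using zN by (simp add: sum_gp_strict)
  finally show ?thesis by (simp add: z1)
qed

lemma prod_cis: "finite A \<Longrightarrow> (\<Prod>x\<in>A. cis (f x)) = cis (\<Sum>x\<in>A. f x)"
  by (induction A rule: finite_induct) (auto simp: cis_mult)

text \<open>Each factor is split by cos t = (cis t + cis (-t)) / 2, and a sign pattern
  \<open>s\<close> records the chosen term, with 0 for the summand 1.\<close>

lemma prod_one_plus_cos_expansion:
  fixes z :: "'a \<Rightarrow> complex" and \<theta> :: "'a \<Rightarrow> real"
  assumes "finite L"
  shows "(\<Prod>l\<in>L. 1 + z l * cos (\<theta> l)) =
     (\<Sum>s\<in>PiE L (\<lambda>_. {-1, 0, 1::int}).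
        (\<Prod>l\<in>L. if s l = 0 then 1 else z l / 2) * cis (\<Sum>l\<in>L. of_int (s l) * \<theta> l))"
proof -
  have "1 + z l * cos (\<theta> l) =
      (\<Sum>t\<in>{-1, 0, 1::int}. (if t = 0 then 1 else z l / 2) * cis (of_int t * \<theta> l))" for l
    by (simp add: complex_eq_iff field_simps)
  then have "(\<Prod>l\<in>L. 1 + z l * cos (\<theta> l)) =
      (\<Prod>l\<in>L. \<Sum>t\<in>{-1, 0, 1::int}. (if t = 0 then 1 else z l / 2) * cis (of_int t * \<theta> l))"
    by (intro prod.cong refl)
  also have "\<dots> = (\<Sum>s\<in>PiE L (\<lambda>_. {-1, 0, 1::int}).
      \<Prod>l\<in>L. (if s l = 0 then 1 else z l / 2) * cis (of_int (s l) * \<theta> l))"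
    using assms by (intro prod_sum_PiE) auto
  finally show ?thesis using assms by (simp add: prod.distrib prod_cis)
qed

text \<open>To first order in \<open>a\<close> this is 1 + a / 2 times the sum of the cosines, as in
  a Riesz product. The factor \<open>\<i>\<close> before \<open>a\<close> keeps the modulus of each
  factor at most sqrt (1 + a^2), so a block stays bounded while a^2 |Q|, rather than a |Q|, is
  bounded.\<close>

definition riesz_block :: "real \<Rightarrow> int set \<Rightarrow> (int \<Rightarrow> real) \<Rightarrow> real" where
  "riesz_block a Q \<theta> = 1 + Im (\<Prod>l\<in>Q. 1 + \<i> * of_real a * cos (\<theta> l)) / 2"

text \<open>
  The coefficient in \<^const>\<open>riesz_block\<close> of a frequency \<open>\<plusminus>\<lambda>\<^sub>1 \<plusminus> \<dots> \<plusminus> \<lambda>\<^sub>k\<close> with distinct \<open>\<lambda>\<^sub>j\<close>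
  in the block, that is \<open>Im ((i a / 2)\<^sup>k) / 2\<close> for \<open>k > 0\<close>.
\<close>
definition block_coeff :: "real \<Rightarrow> nat \<Rightarrow> complex" where
  "block_coeff a k = 0 ^ k - \<i> / 4 * (\<i> * of_real a / 2) ^ k + \<i> / 4 * (- \<i> * of_real a / 2) ^ k"

lemma block_coeff_0: "block_coeff a 0 = 1"
  and block_coeff_1: "block_coeff a (Suc 0) = of_real (a / 4)"
  by (auto simp: block_coeff_def complex_eq_iff)

lemma norm_block_coeff_le:
  assumes "a \<ge> 0"
  shows "cmod (block_coeff a k) \<le> (a / 2) ^ k"
proof (cases k)
  case 0
  then show ?thesis by (simp add: block_coeff_0)
next
  case (Suc m)
  have "cmod (block_coeff a k) = cmod (\<i> / 4 * (- \<i> * of_real a / 2) ^ k - \<i> / 4 * (\<i> * of_real a / 2) ^ k)"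
    using Suc by (simp add: block_coeff_def algebra_simps)
  also have "\<dots> \<le> (a / 2) ^ k / 4 + (a / 2) ^ k / 4"
    using assms by (intro order_trans[OF norm_triangle_ineq4]) (simp add: norm_mult norm_power norm_divide)
  also have "\<dots> \<le> (a / 2) ^ k" using assms by simp
  finally show ?thesis .
qed

text \<open>The product has squared modulus at most (1 + a^2)^|Q| <= exp (a^2 |Q|) <= e < 4. Half
  its imaginary part therefore moves the constant 1 by at most 1.\<close>

lemma riesz_block_bounds:
  assumes "finite Q" "a\<^sup>2 * real (card Q) \<le> 1"
  shows "0 \<le> riesz_block a Q \<theta> \<and> riesz_block a Q \<theta> \<le> 2"
proof -
  have "cmod (1 + \<i> * of_real a * cos (\<theta> l)) ^ 2 \<le> 1 + a\<^sup>2" for l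
  proof -
    have "(a * cos (\<theta> l))\<^sup>2 \<le> a\<^sup>2 * 1"
      unfolding power_mult_distrib by (intro mult_left_mono) (auto simp: abs_square_le_1)
    then show ?thesis by (simp add: cmod_power2)
  qed
  then have "(cmod (\<Prod>l\<in>Q. 1 + \<i> * of_real a * cos (\<theta> l)))\<^sup>2 \<le> (\<Prod>l\<in>Q. 1 + a\<^sup>2)"
    unfolding prod_norm[symmetric] prod_power_distrib by (intro prod_mono) auto
  also have "\<dots> \<le> exp (a\<^sup>2) ^ card Q"
    by (simp add: power_mono)
  also have "\<dots> = exp (a\<^sup>2 * real (card Q))" by (simp add: mult.commute flip: exp_of_nat_mult)
  also have "\<dots> \<le> exp 1" using assms by simp
  also have "\<dots> \<le> 2\<^sup>2" using exp_le by simp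
  finally have "cmod (\<Prod>l\<in>Q. 1 + \<i> * of_real a * cos (\<theta> l)) \<le> 2"
    by (rule power2_le_imp_le) simp
  then have "\<bar>Im (\<Prod>l\<in>Q. 1 + \<i> * of_real a * cos (\<theta> l))\<bar> \<le> 2"
    using abs_Im_le_cmod order_trans by blast
  then show ?thesis unfolding riesz_block_def by linarith
qed

text \<open>The coefficient of a sign pattern factors over the blocks and sees only the number of
  nonzero signs in each. Giving the blocks by a labelling \<open>blk\<close> lets products over all
  blocks be merged and split again.\<close>

lemma riesz_product_expansion:
  fixes L :: "int set" and blk :: "int \<Rightarrow> nat"
  assumes fin: "finite L" and blk: "blk ` L \<subseteq> {..<p}"
  shows "complex_of_real (\<Prod>i<p. riesz_block a {l\<in>L. blk l = i} \<theta>) =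
    (\<Sum>s\<in>PiE L (\<lambda>_. {-1, 0, 1::int}).
       (\<Prod>i<p. block_coeff a (card {l\<in>L. blk l = i \<and> s l \<noteq> 0})) * cis (\<Sum>l\<in>L. of_int (s l) * \<theta> l))"
proof -
  \<comment> \<open>Writing \<open>Im w\<close> as \<open>(w - cnj w) / (2 i)\<close> makes each block a combination of three pure products,
      so that all products over blocks merge into products over \<open>L\<close>.\<close>
  define c where "c = (\<lambda>j::nat. if j = 0 then 1 else if j = 1 then - \<i> / 4 else \<i> / 4)"
  define z where "z = (\<lambda>j::nat. if j = 0 then 0 else if j = 1 then \<i> * of_real a else - \<i> * of_real a)"
  define P where "P = (\<lambda>i. {l\<in>L. blk l = i})"
  define E where "E = PiE L (\<lambda>_. {-1, 0, 1::int})"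
  define e where "e = (\<lambda>s. cis (\<Sum>l\<in>L. of_int (s l :: int) * \<theta> l))"
  have finP: "finite (P i)" for i using fin by (simp add: P_def)
  have group: "(\<Prod>i<p. \<Prod>l\<in>P i. f l) = (\<Prod>l\<in>L. f l)" for f :: "int \<Rightarrow> complex"
    unfolding P_def by (rule prod.group) (use fin blk in auto)
  have block: "complex_of_real (riesz_block a (P i) \<theta>) =
      (\<Sum>j\<in>{0, 1, 2}. c j * (\<Prod>l\<in>P i. 1 + z j * cos (\<theta> l)))" for i
  proof -
    define w where "w = (\<Prod>l\<in>P i. 1 + \<i> * of_real a * cos (\<theta> l))"
    have "(\<Prod>l\<in>P i. 1 + - \<i> * of_real a * cos (\<theta> l)) = cnj w"
      by (simp add: w_def)
    moreover have "complex_of_real (1 + Im w / 2) = 1 + - \<i> / 4 * w + \<i> / 4 * cnj w"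
      by (simp add: complex_eq_iff)
    ultimately show ?thesis
      by (simp add: riesz_block_def c_def z_def flip: w_def)
  qed
  have coeff: "(\<Sum>j\<in>{0, 1, 2}. c j * (z j / 2) ^ k) = block_coeff a k" for k
    by (simp add: block_coeff_def c_def z_def)
  have "complex_of_real (\<Prod>i<p. riesz_block a (P i) \<theta>) =
      (\<Prod>i<p. \<Sum>j\<in>{0, 1, 2}. c j * (\<Prod>l\<in>P i. 1 + z j * cos (\<theta> l)))"
    by (simp only: of_real_prod block)
  also have "\<dots> = (\<Sum>J\<in>PiE {..<p} (\<lambda>_. {0, 1, 2}). \<Prod>i<p. c (J i) * (\<Prod>l\<in>P i. 1 + z (J i) * cos (\<theta> l)))"
    by (intro prod_sum_PiE) auto
  also have "\<dots> = (\<Sum>J\<in>PiE {..<p} (\<lambda>_. {0, 1, 2}). \<Sum>s\<in>E.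
      e s * (\<Prod>i<p. c (J i) * (\<Prod>l\<in>P i. if s l = 0 then 1 else z (J i) / 2)))"
  proof (intro sum.cong refl)
    fix J
    have "(\<Prod>i<p. c (J i) * (\<Prod>l\<in>P i. 1 + z (J i) * cos (\<theta> l))) =
        (\<Prod>i<p. c (J i)) * (\<Prod>i<p. \<Prod>l\<in>P i. 1 + z (J (blk l)) * cos (\<theta> l))"
      unfolding prod.distrib by (intro arg_cong2[where f = "(*)"] refl prod.cong) (auto simp: P_def)
    \<comment> \<open>Once \<open>J\<close> has fixed one pure product per block, these form a
      single product over \<open>L\<close>, to which the expansion into sign patterns
      applies.\<close>
    also have "\<dots> = (\<Prod>i<p. c (J i)) * (\<Sum>s\<in>E. (\<Prod>l\<in>L. if s l = 0 then 1 else z (J (blk l)) / 2) * e s)"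
      unfolding group by (simp only: prod_one_plus_cos_expansion[OF fin] E_def e_def)
    also have "\<dots> = (\<Sum>s\<in>E. e s * ((\<Prod>i<p. c (J i)) * (\<Prod>i<p. \<Prod>l\<in>P i. if s l = 0 then 1 else z (J (blk l)) / 2)))"
      unfolding group sum_distrib_left by (simp only: mult_ac)
    also have "\<dots> = (\<Sum>s\<in>E. e s * (\<Prod>i<p. c (J i) * (\<Prod>l\<in>P i. if s l = 0 then 1 else z (J i) / 2)))"
      unfolding prod.distrib
      by (intro sum.cong arg_cong2[where f = "(*)"] refl prod.cong) (auto simp: P_def)
    finally show "(\<Prod>i<p. c (J i) * (\<Prod>l\<in>P i. 1 + z (J i) * cos (\<theta> l))) =
      (\<Sum>s\<in>E. e s * (\<Prod>i<p. c (J i) * (\<Prod>l\<in>P i. if s l = 0 then 1 else z (J i) / 2)))" .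
  qed
  also have "\<dots> = (\<Sum>s\<in>E. e s * (\<Sum>J\<in>PiE {..<p} (\<lambda>_. {0, 1, 2}).
      \<Prod>i<p. c (J i) * (\<Prod>l\<in>P i. if s l = 0 then 1 else z (J i) / 2)))"
    by (subst sum.swap) (simp only: sum_distrib_left)
  \<comment> \<open>For a fixed pattern the sum over \<open>J\<close> factors over the blocks, and
    each factor is a block coefficient.\<close>
  also have "\<dots> = (\<Sum>s\<in>E. e s * (\<Prod>i<p. \<Sum>j\<in>{0, 1, 2}. c j * (\<Prod>l\<in>P i. if s l = 0 then 1 else z j / 2)))"
    by (subst prod_sum_PiE) auto
  also have "\<dots> = (\<Sum>s\<in>E. e s * (\<Prod>i<p. block_coeff a (card {l\<in>L. blk l = i \<and> s l \<noteq> 0})))"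
  proof (intro sum.cong refl arg_cong2[where f = "(*)"] prod.cong)
    fix s i
    have "(\<Prod>l\<in>P i. if s l = 0 then 1 else w) = w ^ card {l\<in>L. blk l = i \<and> s l \<noteq> 0}" for w :: complex
    proof -
      have "(\<Prod>l\<in>P i. if s l = 0 then 1 else w) = (\<Prod>l\<in>{l\<in>L. blk l = i \<and> s l \<noteq> 0}. w)"
        using finP by (intro prod.mono_neutral_cong_right) (auto simp: P_def)
      then show ?thesis by simp
    qed
    then show "(\<Sum>j\<in>{0, 1, 2}. c j * (\<Prod>l\<in>P i. if s l = 0 then 1 else z j / 2)) =
        block_coeff a (card {l\<in>L. blk l = i \<and> s l \<noteq> 0})"
      by (simp only: coeff)
  qed
  finally show ?thesis by (simp add: P_def E_def e_def mult.commute)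
qed

lemma fourier_riesz_product:
  fixes L :: "int set" and blk :: "int \<Rightarrow> nat" and r :: int
  assumes N: "N > 0" and fin: "finite L" and blk: "blk ` L \<subseteq> {..<p}"
  shows "(\<Sum>x\<in>ZN N. complex_of_real (\<Prod>i<p. riesz_block a {l\<in>L. blk l = i} (\<lambda>l. 2 * pi * of_int x * of_int l / of_nat N))
        * cis (2 * pi * of_int x * of_int r / of_nat N)) =
    of_nat N * (\<Sum>s\<in>{s\<in>PiE L (\<lambda>_. {-1, 0, 1::int}). int N dvd (\<Sum>l\<in>L. s l * l) + r}.
       \<Prod>i<p. block_coeff a (card {l\<in>L. blk l = i \<and> s l \<noteq> 0}))"
proof -
  define E where "E = PiE L (\<lambda>_. {-1, 0, 1::int})"
  define V where "V = (\<lambda>s. \<Prod>i<p. block_coeff a (card {l\<in>L. blk l = i \<and> s l \<noteq> (0::int)}))"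
  have finE: "finite E" using fin by (auto simp: E_def intro!: finite_PiE)
  have "(\<Sum>x\<in>ZN N. complex_of_real (\<Prod>i<p. riesz_block a {l\<in>L. blk l = i} (\<lambda>l. 2 * pi * of_int x * of_int l / of_nat N))
        * cis (2 * pi * of_int x * of_int r / of_nat N)) =
      (\<Sum>x\<in>ZN N. \<Sum>s\<in>E. V s * cis (2 * pi * of_int x * of_int ((\<Sum>l\<in>L. s l * l) + r) / of_nat N))"
  proof (intro sum.cong refl)
    fix x
    have "cis (\<Sum>l\<in>L. of_int (s l) * (2 * pi * of_int x * of_int l / of_nat N)) * cis (2 * pi * of_int x * of_int r / of_nat N)
        = cis (2 * pi * of_int x * of_int ((\<Sum>l\<in>L. s l * l) + r) / of_nat N)" for s
      by (simp add: cis_mult sum_distrib_left sum_divide_distrib distrib_left add_divide_distrib mult_ac add.commute)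
    then show "complex_of_real (\<Prod>i<p. riesz_block a {l\<in>L. blk l = i} (\<lambda>l. 2 * pi * of_int x * of_int l / of_nat N))
        * cis (2 * pi * of_int x * of_int r / of_nat N) =
      (\<Sum>s\<in>E. V s * cis (2 * pi * of_int x * of_int ((\<Sum>l\<in>L. s l * l) + r) / of_nat N))"
      unfolding riesz_product_expansion[OF fin blk] E_def V_def sum_distrib_right by (simp only: mult.assoc)
  qed
  also have "\<dots> = (\<Sum>s\<in>E. V s * (\<Sum>x\<in>ZN N. cis (2 * pi * of_int x * of_int ((\<Sum>l\<in>L. s l * l) + r) / of_nat N)))"
    by (subst sum.swap) (simp only: sum_distrib_left)
  also have "\<dots> = (\<Sum>s\<in>E. if int N dvd (\<Sum>l\<in>L. s l * l) + r then of_nat N * V s else 0)"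
    unfolding character_orthogonality[OF N] by (intro sum.cong) auto
  also have "\<dots> = (\<Sum>s\<in>{s\<in>E. int N dvd (\<Sum>l\<in>L. s l * l) + r}. of_nat N * V s)"
    using finE by (simp add: sum.inter_filter)
  finally show ?thesis by (simp add: sum_distrib_left E_def V_def)
qed

text \<open>The form of dissociativity that a Riesz product needs: a frequency stems from at most
  one pattern. \<open>PiE\<close> fixes the values outside \<open>L\<close>, without which
  injectivity would fail.\<close>

definition dissociated :: "nat \<Rightarrow> int set \<Rightarrow> bool" where
  "dissociated N L \<longleftrightarrow> inj_on (\<lambda>s. (\<Sum>l\<in>L. s l * l) mod int N) (PiE L (\<lambda>_. {-1, 0, 1}))"

text \<open>The difference of two sign patterns has coefficients of size at most 2. Blocks of
  comparable size have at most 2 |L| / p elements, so the total size on a block is at most 4 |L| / p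
  <= k, and a coincidence of sums is a relation that the family forces to be trivial.\<close>

lemma lambda_family_dissociated:
  fixes k :: real
  assumes "in_Lambda_family N k (ereal k) p L" "p > 0" "k \<ge> 2" "4 * real (card L) \<le> k * real p"
  obtains blk where "blk ` L \<subseteq> {..<p}"
    and "\<And>i. i < p \<Longrightarrow> real p * real (card {l\<in>L. blk l = i}) \<le> 2 * real (card L)"
    and "dissociated N L"
proof -
  have "L \<subseteq> ZN N"
    using assms(1) unfolding in_Lambda_family_def by (rule conjunct1)
  have "\<exists>P :: nat \<Rightarrow> int set.
        (\<Union>i<p. P i) = L \<and>
        (\<forall>i<p. \<forall>j<p. i \<noteq> j \<longrightarrow> P i \<inter> P j = {}) \<and>
        (\<forall>i<p. \<forall>j<p. card (P i) \<le> 2 * card (P j)) \<and>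
        (\<forall>c :: int \<Rightarrow> int.
           ((\<forall>x\<in>L. ereal (of_int \<bar>c x\<bar>) \<le> ereal k) \<and>
            (\<forall>i<p. of_int (\<Sum>x\<in>P i. \<bar>c x\<bar>) \<le> k) \<and>
            (\<Sum>x\<in>L. c x * x) mod int N = 0)
           \<longrightarrow> (\<forall>x\<in>L. c x = 0))"
    using assms(1) unfolding in_Lambda_family_def by (rule conjunct2)
  then obtain P where P: "(\<Union>i<p. P i) = L"
    "\<forall>i<p. \<forall>j<p. i \<noteq> j \<longrightarrow> P i \<inter> P j = {}"
    "\<forall>i<p. \<forall>j<p. card (P i) \<le> 2 * card (P j)"
    and rel: "\<forall>c :: int \<Rightarrow> int. ((\<forall>x\<in>L. ereal (of_int \<bar>c x\<bar>) \<le> ereal k) \<and>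
            (\<forall>i<p. of_int (\<Sum>x\<in>P i. \<bar>c x\<bar>) \<le> k) \<and> (\<Sum>x\<in>L. c x * x) mod int N = 0)
           \<longrightarrow> (\<forall>x\<in>L. c x = 0)"
    by (elim exE conjE) (rule that)
  have finL: "finite L" by (rule finite_subset[OF \<open>L \<subseteq> ZN N\<close> finite_ZN])
  have finP: "finite (P i)" if "i < p" for i
    using P(1) that by (intro finite_subset[OF _ finL]) auto
  define blk where "blk = (\<lambda>l. SOME i. i < p \<and> l \<in> P i)"
  have blk: "blk l < p \<and> l \<in> P (blk l)" if "l \<in> L" for l
    unfolding blk_def by (rule someI_ex) (use that P(1) in auto)
  have fibre: "{l\<in>L. blk l = i} = P i" if "i < p" for i
  proof safe
    fix l assume l: "l \<in> P i"
    then show "l \<in> L" using P(1) that by auto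
    with blk[of l] l that P(2) show "blk l = i" by auto
  next
    fix l assume "l \<in> L" "i = blk l"
    then show "l \<in> P (blk l)" using blk by blast
  qed
  have cardP: "real p * real (card (P i)) \<le> 2 * real (card L)" if "i < p" for i
  proof -
    have "p * card (P i) = (\<Sum>j<p. card (P i))" by simp
    also have "\<dots> \<le> (\<Sum>j<p. 2 * card (P j))" using that P(3) by (intro sum_mono) auto
    also have "\<dots> = 2 * card (\<Union>j<p. P j)"
      using P(2) finP by (subst card_UN_disjoint) (auto simp: sum_distrib_left)
    finally have "p * card (P i) \<le> 2 * card L" using P(1) by simp
    then have "real (p * card (P i)) \<le> real (2 * card L)" by (simp only: of_nat_le_iff)
    then show ?thesis by simp
  qed
  show thesis
  proof (rule that[of blk])
    show "blk ` L \<subseteq> {..<p}" using blk by auto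
    show "real p * real (card {l\<in>L. blk l = i}) \<le> 2 * real (card L)" if "i < p" for i
      using cardP that fibre by simp
    show "dissociated N L"
      unfolding dissociated_def
    proof (rule inj_onI)
      fix s s' :: "int \<Rightarrow> int"
      assume s: "s \<in> PiE L (\<lambda>_. {-1, 0, 1})" "s' \<in> PiE L (\<lambda>_. {-1, 0, 1})"
        and "(\<Sum>l\<in>L. s l * l) mod int N = (\<Sum>l\<in>L. s' l * l) mod int N"
      then have dvd: "int N dvd (\<Sum>l\<in>L. s l * l) - (\<Sum>l\<in>L. s' l * l)"
        by (simp add: mod_eq_dvd_iff)
      have le2: "\<bar>s l - s' l\<bar> \<le> 2" if "l \<in> L" for l
        using PiE_mem[OF s(1) that] PiE_mem[OF s(2) that] by auto
      have "\<forall>l\<in>L. s l - s' l = 0"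
      proof (rule mp[OF spec[OF rel, of "\<lambda>l. s l - s' l"]], intro conjI ballI allI impI)
        show "ereal (of_int \<bar>s x - s' x\<bar>) \<le> ereal k" if "x \<in> L" for x
        proof -
          have "real_of_int \<bar>s x - s' x\<bar> \<le> of_int 2" using le2[OF that] by (simp only: of_int_le_iff)
          then show ?thesis using assms(3) by simp
        qed
        show "of_int (\<Sum>x\<in>P i. \<bar>s x - s' x\<bar>) \<le> k" if i: "i < p" for i
        proof -
          have "(\<Sum>x\<in>P i. \<bar>s x - s' x\<bar>) \<le> (\<Sum>x\<in>P i. 2)"
            using i P(1) by (intro sum_mono le2) auto
          then have "(\<Sum>x\<in>P i. \<bar>s x - s' x\<bar>) \<le> int (2 * card (P i))" by simp
          then have "real_of_int (\<Sum>x\<in>P i. \<bar>s x - s' x\<bar>) \<le> of_int (int (2 * card (P i)))"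
            by (simp only: of_int_le_iff)
          also have "\<dots> = 2 * real (card (P i))" by simp
          also have "\<dots> \<le> k"
          proof -
            have "real p * (2 * real (card (P i))) \<le> real p * k"
              using cardP[OF i] assms(4) by (simp add: mult.commute)
            then show ?thesis using assms(2) by simp
          qed
          finally show ?thesis .
        qed
        show "(\<Sum>x\<in>L. (s x - s' x) * x) mod int N = 0"
          using dvd by (simp add: left_diff_distrib sum_subtractf mod_eq_0_iff_dvd)
      qed
      then show "s = s'"
        by (intro PiE_ext[OF s]) auto
    qed
  qed
qed

text \<open>Dissociation leaves at most one pattern for each \<open>r\<close>. The zero pattern
  belongs to 0, patterns with one nonzero sign to \<open>L\<close> and its negative, and all others
  have two or more nonzero signs, hence a coefficient of modulus at most (a / 2)^2.\<close>

lemma fourier_riesz_product_values: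
  fixes L :: "int set" and blk :: "int \<Rightarrow> nat"
  assumes N: "N > 0" and L: "L \<subseteq> ZN N" and blk: "blk ` L \<subseteq> {..<p}" and a: "0 \<le> a" "a \<le> 2"
    and diss: "dissociated N L"
    and F_def: "\<And>r. F r = (\<Sum>x\<in>ZN N.
        complex_of_real (\<Prod>i<p. riesz_block a {l\<in>L. blk l = i} (\<lambda>l. 2 * pi * of_int x * of_int l / of_nat N))
        * cis (2 * pi * of_int x * of_int r / of_nat N))"
  shows "F 0 = of_nat N"
    and "r \<in> L \<union> neg_set N L \<Longrightarrow> F r = of_nat N * of_real (a / 4)"
    and "r \<in> ZN N \<Longrightarrow> r \<notin> {0} \<union> L \<union> neg_set N L \<Longrightarrow> cmod (F r) \<le> real N * (a / 2)\<^sup>2"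
    and "0 \<notin> L" "0 \<notin> neg_set N L" "L \<inter> neg_set N L = {}"
proof -
  define E where "E = PiE L (\<lambda>_. {-1, 0, 1::int})"
  define V where "V = (\<lambda>s. \<Prod>i<p. block_coeff a (card {l\<in>L. blk l = i \<and> s l \<noteq> (0::int)}))"
  define \<phi> where "\<phi> = (\<lambda>s. \<Sum>l\<in>L. s l * l)"
  define u where "u = (\<lambda>l0 (e::int). \<lambda>l\<in>L. if l = l0 then e else 0)"
  have finL: "finite L" by (rule finite_subset[OF L finite_ZN])
  have F: "F r = of_nat N * (\<Sum>s\<in>{s\<in>E. int N dvd \<phi> s + r}. V s)" for r
    unfolding F_def E_def V_def \<phi>_def by (rule fourier_riesz_product[OF N finL blk])
  have uniq: "s = s'" if "s \<in> E" "s' \<in> E" "int N dvd \<phi> s - \<phi> s'" for s s'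
    using diss that unfolding dissociated_def E_def \<phi>_def by (auto dest: inj_onD simp: mod_eq_dvd_iff)
  have F_eq: "F r = of_nat N * V s" if "s \<in> E" "int N dvd \<phi> s + r" for s r
  proof -
    have "{s\<in>E. int N dvd \<phi> s + r} = {s}"
      using that uniq by (auto dest: dvd_diff)
    then show ?thesis by (simp add: F)
  qed
  have uE: "u l0 e \<in> E" if "e \<in> {-1, 0, 1}" for l0 e
    using that by (auto simp: u_def E_def)
  have \<phi>u: "\<phi> (u l0 e) = e * l0" if "l0 \<in> L" for l0 e
    using that finL by (simp add: \<phi>_def u_def if_distrib[of "\<lambda>t. t * _"] sum.delta cong: if_cong)
  define z where "z = (\<lambda>l\<in>L. 0::int)"
  have z: "z \<in> E" "\<phi> z = 0" by (auto simp: z_def E_def \<phi>_def)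
  have "V z = 1" by (simp add: V_def z_def block_coeff_0 cong: conj_cong)
  then show "F 0 = of_nat N" using F_eq[of z 0] z by simp
  have Vu: "V (u l0 e) = of_real (a / 4)" if l0: "l0 \<in> L" and e: "e \<noteq> 0" for l0 e
  proof -
    have "{l\<in>L. blk l = i \<and> u l0 e l \<noteq> 0} = (if i = blk l0 then {l0} else {})" for i
      using l0 e by (auto simp: u_def)
    then have "V (u l0 e) = (\<Prod>i<p. if i = blk l0 then of_real (a / 4) else 1)"
      unfolding V_def by (intro prod.cong refl) (simp add: block_coeff_0 block_coeff_1)
    also have "\<dots> = of_real (a / 4)" using blk l0 by (subst prod.delta) auto
    finally show ?thesis .
  qed
  have u_neq: "u l0 e \<noteq> z" if "l0 \<in> L" "e \<noteq> 0" for l0 e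
  proof
    assume "u l0 e = z"
    then have "u l0 e l0 = z l0" by simp
    then show False using that by (simp add: u_def z_def)
  qed
  have dvd_neg: "int N dvd l + (- l) mod int N" for l
    by (simp add: mod_0_imp_dvd mod_add_right_eq)
  show "F r = of_nat N * of_real (a / 4)" if r: "r \<in> L \<union> neg_set N L"
  proof (cases "r \<in> L")
    case True
    \<comment> \<open>The transform at \<open>r\<close> picks the pattern of frequency
      \<open>- r\<close>, hence the sign -1 for \<open>r\<close> in \<open>L\<close>.\<close>
    then show ?thesis using F_eq[of "u r (-1)" r] uE[of "-1" r] Vu[of r "-1"] \<phi>u[of r "-1"] by simp
  next
    case False
    then obtain l where l: "l \<in> L" "r = (- l) mod int N" using r by (auto simp: neg_set_def)
    then show ?thesis
      using F_eq[of "u l 1" r] uE[of 1 l] Vu[of l 1] \<phi>u[of l 1] dvd_neg[of l] by simp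
  qed
  have not_dvd: "\<not> int N dvd l" if "l \<in> L" for l
  proof
    assume "int N dvd l"
    then have "u l 1 = z" using z \<phi>u[OF that, of 1] by (intro uniq uE) auto
    then show False using u_neq[OF that, of 1] by simp
  qed
  show "0 \<notin> L" using not_dvd[of 0] by auto
  show "0 \<notin> neg_set N L"
  proof
    assume "0 \<in> neg_set N L"
    then obtain l where l: "l \<in> L" "(- l) mod int N = 0" by (auto simp: neg_set_def)
    then have "int N dvd l" by (simp add: mod_eq_0_iff_dvd)
    then show False using not_dvd l by blast
  qed
  show "L \<inter> neg_set N L = {}"
  proof safe
    fix l' assume l': "l' \<in> L" "l' \<in> neg_set N L"
    then obtain l where l: "l \<in> L" "l' = (- l) mod int N" by (auto simp: neg_set_def)
    \<comment> \<open>If \<open>l'\<close> is the negative of \<open>l\<close>, sign plus at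
      \<open>l\<close> and sign minus at \<open>l'\<close> give the same frequency, although the
      values of these patterns at \<open>l\<close> are 1 and at most 0.\<close>
    have "int N dvd \<phi> (u l 1) - \<phi> (u l' (-1))"
      using \<phi>u[OF l(1), of 1] \<phi>u[OF l'(1), of "-1"] dvd_neg[of l] l(2) by simp
    then have "u l 1 = u l' (-1)" using uE by (intro uniq) auto
    then have "u l 1 l = u l' (-1) l" by simp
    then show "l' \<in> {}" using l by (simp add: u_def split: if_splits)
  qed
  show "cmod (F r) \<le> real N * (a / 2)\<^sup>2" if r: "r \<in> ZN N" "r \<notin> {0} \<union> L \<union> neg_set N L"
  proof (cases "\<exists>s\<in>E. int N dvd \<phi> s + r")
    case False
    then have "{s\<in>E. int N dvd \<phi> s + r} = {}" by blast
    then show ?thesis unfolding F by (simp only: sum.empty) simp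
  next
    case True
    then obtain s where s: "s \<in> E" "int N dvd \<phi> s + r" by blast
    define T where "T = {l\<in>L. s l \<noteq> 0}"
    have finT: "finite T" using finL by (simp add: T_def)
    have \<phi>T: "\<phi> s = (\<Sum>l\<in>T. s l * l)"
      unfolding \<phi>_def T_def using finL by (intro sum.mono_neutral_right) auto
    have sT: "s l = 1 \<or> s l = -1" if "l \<in> T" for l
      using that s(1) by (auto simp: T_def E_def dest: PiE_mem)
    have mod_eq: "r = x mod int N" if "int N dvd r - x" for x
    proof -
      have "r mod int N = x mod int N" using that by (simp add: mod_eq_dvd_iff)
      then show ?thesis using r(1) by (simp add: ZN_def)
    qed
    have "card T \<noteq> 0"
    proof
      assume "card T = 0"
      then have "\<phi> s = 0" using finT \<phi>T by simp
      then have "r = 0 mod int N" using s by (intro mod_eq) simp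
      then show False using r by simp
    qed
    moreover have "card T \<noteq> 1"
    proof
      assume "card T = 1"
      then obtain l where l: "T = {l}" by (auto simp: card_1_singleton_iff)
      then have lL: "l \<in> L" by (auto simp: T_def)
      then have lmod: "l mod int N = l" using L by (auto simp: ZN_def)
      have "int N dvd s l * l + r" using \<phi>T l s(2) by simp
      then have "r = l mod int N \<or> r = (- l) mod int N"
        using sT[of l] l mod_eq[of l] mod_eq[of "- l"] by (auto simp: add.commute)
      then show False using lmod lL r(2) by (auto simp: neg_set_def)
    qed
    ultimately have T2: "card T \<ge> 2" by linarith
    have "cmod (V s) \<le> (\<Prod>i<p. (a / 2) ^ card {l\<in>L. blk l = i \<and> s l \<noteq> 0})"
      unfolding V_def prod_norm[symmetric] using a by (intro prod_mono) (auto intro: norm_block_coeff_le)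
    \<comment> \<open>The blocks partition the support \<open>T\<close>, so the exponents add up to
      \<open>card T\<close>.\<close>
    also have "\<dots> = (a / 2) ^ (\<Sum>i<p. card {l\<in>T. blk l = i})"
      unfolding power_sum by (intro prod.cong arg_cong[where f = "\<lambda>A. _ ^ card A"] refl) (auto simp: T_def)
    also have "(\<Sum>i<p. card {l\<in>T. blk l = i}) = card T"
      using sum.group[of T "{..<p}" blk "\<lambda>_. 1::nat"] finT blk by (auto simp: T_def)
    also have "(a / 2) ^ card T \<le> (a / 2) ^ 2"
      using a T2 by (intro power_decreasing) auto
    finally show ?thesis
      unfolding F_eq[OF s] norm_mult by (simp add: mult_left_mono)
  qed
qed

section \<open>The set with prescribed spectrum\<close>

theorem theorem13:
  fixes N :: nat and \<delta> \<alpha> :: real and L :: "int set"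
  assumes "N > 0"
    and "\<delta> \<le> 1/8"
    and "640 * real N powr (-1/2) < \<alpha>"
    and "\<alpha> \<le> \<delta> / 2^27"
    and "in_Lambda_family N ((\<delta>/\<alpha>)^2) (ereal ((\<delta>/\<alpha>)^2)) (nat \<lfloor>log 2 (1/\<delta>)\<rfloor>) L"
    and "real (card L) \<le> (\<delta>/\<alpha>)^2 * log 2 (1/\<delta>) / 2^12"
  shows "\<exists>A. A \<subseteq> ZN N \<and> card A = nat \<lfloor>\<delta> * real N\<rfloor> \<and>
           large_spectrum N \<alpha> A = {0} \<union> L \<union> neg_set N L \<and>
           0 \<notin> L \<and> 0 \<notin> neg_set N L \<and> L \<inter> neg_set N L = {}"
proof -

  \<comment> \<open>Choice of parameters\<close>
  define k where "k = (\<delta>/\<alpha>)\<^sup>2"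
  define q where "q = log 2 (1/\<delta>)"
  define p where "p = nat \<lfloor>q\<rfloor>"
  \<comment> \<open>The coefficient on \<open>L\<close> becomes d N a / 4 = 4 d N \<alpha> /
    \<delta>, which is twice the threshold \<alpha> N even when \<open>d\<close> is only \<delta> /
    2.\<close>
  define a where "a = 16 * \<alpha> / \<delta>"
  define M where "M = nat \<lfloor>\<delta> * real N\<rfloor>"
  \<comment> \<open>The density M / N in place of \<delta> makes the total mass the integer
    \<open>M\<close>, as the rounding requires.\<close>
  define d where "d = real M / real N"
  have N: "real N > 0" using assms(1) by simp
  have sqrtN: "real N powr (-1/2) = 1 / sqrt (real N)"
    using N by (simp add: powr_minus_divide powr_half_sqrt)
  have "\<alpha> > 0" using assms(3) N by (smt (verit) powr_ge_zero)
  have "\<delta> > 0" using \<open>\<alpha> > 0\<close> assms(4) by (simp add: field_simps)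
  have \<delta>\<alpha>: "2 ^ 27 \<le> \<delta> / \<alpha>" using assms(4) \<open>\<alpha> > 0\<close> by (simp add: field_simps)
  have \<alpha>N: "640 * sqrt (real N) < \<alpha> * real N"
  proof -
    have "640 < \<alpha> * sqrt (real N)" using assms(3) N unfolding sqrtN by (simp add: field_simps)
    then have "640 * sqrt (real N) < \<alpha> * sqrt (real N) * sqrt (real N)"
      using N by (intro mult_strict_right_mono) auto
    then show ?thesis by (simp add: mult.assoc)
  qed
  have sqrt_ge_1: "sqrt (real N) \<ge> 1" using assms(1) by simp
  have k: "k \<ge> 2"
  proof -
    have "(2 ^ 27)\<^sup>2 \<le> k" unfolding k_def using \<delta>\<alpha> by (intro power_mono) auto
    then show ?thesis by simp
  qed
  have q: "q \<ge> 3"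
  proof -
    have "2 powr 3 \<le> 1 / \<delta>" using assms(2) \<open>\<delta> > 0\<close> by (simp add: field_simps)
    then show ?thesis unfolding q_def using \<open>\<delta> > 0\<close> by (subst le_log_iff) auto
  qed
  have p: "real p \<le> q" "q \<le> 2 * real p" "p > 0"
  proof -
    show "real p \<le> q" using q unfolding p_def by simp
    have "q \<le> real p + 1" using q unfolding p_def by linarith
    then show "q \<le> 2 * real p" using q by linarith
    then show "p > 0" using q by (cases p) auto
  qed
  \<comment> \<open>Each of the \<open>p\<close> blocks is at most 2, so this bound keeps \<delta>
    times their product at most 1.\<close>
  have two_p: "2 ^ p \<le> 1 / \<delta>"
  proof -
    have "2 powr real p \<le> 2 powr q" using p by (intro powr_mono) auto
    also have "\<dots> = 1 / \<delta>" using \<open>\<delta> > 0\<close> by (simp add: q_def)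
    finally show ?thesis by (simp add: powr_realpow)
  qed
  have fam: "in_Lambda_family N k (ereal k) p L"
    using assms(5) unfolding k_def p_def q_def .
  then have LZ: "L \<subseteq> ZN N" unfolding in_Lambda_family_def by (rule conjunct1)
  \<comment> \<open>Replacing \<open>q\<close> by \<open>2 * p\<close> costs a factor 2, which
    leaves |L| <= k p / 2^11 and thus blocks of at most k / 2^10 elements.\<close>
  have cardL: "1024 * (2 * real (card L)) \<le> k * real p"
  proof -
    have "real (card L) \<le> k * q / 2 ^ 12" using assms(6) by (simp only: k_def q_def)
    also have "\<dots> \<le> k * (2 * real p) / 2 ^ 12"
      using k p by (intro divide_right_mono mult_left_mono) auto
    finally show ?thesis by simp
  qed
  then have cardL4: "4 * real (card L) \<le> k * real p" by simp
  obtain blk where blk: "blk ` L \<subseteq> {..<p}"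
    "\<And>i. i < p \<Longrightarrow> real p * real (card {l\<in>L. blk l = i}) \<le> 2 * real (card L)"
    "dissociated N L"
    by (rule lambda_family_dissociated[OF fam p(3) k cardL4]) (rule that)
  have finL: "finite L" by (rule finite_subset[OF LZ finite_ZN])
  have a0: "a \<ge> 0" using \<open>\<alpha> > 0\<close> \<open>\<delta> > 0\<close> by (simp add: a_def)
  have a2: "a \<le> 2" using assms(4) \<open>\<delta> > 0\<close> by (simp add: a_def field_simps)
  have ak: "a\<^sup>2 * k = 256" using \<open>\<alpha> > 0\<close> \<open>\<delta> > 0\<close> by (simp add: a_def k_def power_divide power_mult_distrib)
  have card_block: "a\<^sup>2 * real (card {l\<in>L. blk l = i}) \<le> 1" if "i < p" for i
  proof -
    have "1024 * (real p * real (card {l\<in>L. blk l = i})) \<le> k * real p"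
      using blk(2)[OF that] cardL by linarith
    then have "1024 * real (card {l\<in>L. blk l = i}) \<le> k" using p(3) by (simp add: mult.left_commute)
    then have "a\<^sup>2 * (1024 * real (card {l\<in>L. blk l = i})) \<le> a\<^sup>2 * k" by (intro mult_left_mono) auto
    then show ?thesis using ak by simp
  qed

  \<comment> \<open>The density and its Fourier transform\<close>
  let ?\<theta> = "\<lambda>x l. 2 * pi * of_int x * of_int l / of_nat N"
  define R where "R = (\<lambda>x. \<Prod>i<p. riesz_block a {l\<in>L. blk l = i} (?\<theta> x))"
  define F where "F = (\<lambda>r. \<Sum>x\<in>ZN N. complex_of_real (R x) * cis (2 * pi * of_int x * of_int r / of_nat N))"
  have F_eq: "F r = (\<Sum>x\<in>ZN N. complex_of_real (\<Prod>i<p. riesz_block a {l\<in>L. blk l = i} (?\<theta> x))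
      * cis (2 * pi * of_int x * of_int r / of_nat N))" for r
    unfolding F_def R_def ..
  note transform = fourier_riesz_product_values[where F = F, OF assms(1) LZ blk(1) a0 a2 blk(3) F_eq]
  have \<delta>N: "\<delta> * real N \<ge> 2"
  proof -
    have "2 \<le> \<alpha> * real N" using \<alpha>N sqrt_ge_1 by linarith
    also have "\<dots> \<le> \<delta> * real N" using assms(4) \<open>\<delta> > 0\<close> N by (intro mult_right_mono) auto
    finally show ?thesis .
  qed
  have M: "real M \<le> \<delta> * real N" "\<delta> * real N / 2 \<le> real M"
    using \<delta>N unfolding M_def by linarith+
  have d: "0 \<le> d" "d \<le> \<delta>" "\<delta> / 2 \<le> d"
    using M N by (auto simp: d_def field_simps)
  have R_bounds: "0 \<le> R x \<and> R x \<le> 2 ^ p" for x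
  proof -
    have b: "0 \<le> riesz_block a {l\<in>L. blk l = i} (?\<theta> x) \<and> riesz_block a {l\<in>L. blk l = i} (?\<theta> x) \<le> 2"
      if "i < p" for i
      using card_block[OF that] finL by (intro riesz_block_bounds) auto
    then have "R x \<le> (\<Prod>i<p. 2)" unfolding R_def by (intro prod_mono) auto
    moreover have "0 \<le> R x" unfolding R_def using b by (intro prod_nonneg) auto
    ultimately show ?thesis by simp
  qed
  have f_bounds: "0 \<le> d * R x \<and> d * R x \<le> 1" for x
  proof -
    have "d * R x \<le> \<delta> * (1 / \<delta>)"
      using d R_bounds[of x] two_p \<open>\<delta> > 0\<close> by (intro mult_mono) auto
    then show ?thesis using d R_bounds[of x] \<open>\<delta> > 0\<close> by simp
  qed

  \<comment> \<open>Rounding the density to a set\<close>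
  have "complex_of_real (\<Sum>x\<in>ZN N. R x) = of_real (real N)"
    using transform(1) by (simp add: F_def)
  then have "(\<Sum>x\<in>ZN N. R x) = real N" by (simp only: of_real_eq_iff)
  then have "(\<Sum>x\<in>ZN N. d * R x) = real M" using N unfolding sum_distrib_left[symmetric] by (simp add: d_def)
  then obtain A where A: "A \<subseteq> ZN N" "card A = M"
    "\<And>r. r \<in> ZN N \<Longrightarrow> cmod (fourier_ind N A r - (\<Sum>x\<in>ZN N. of_real (d * R x) * cis (2 * pi * of_int x * of_int r / of_nat N)))
        \<le> 220 * sqrt (real N)"
    using fourier_rounding[OF assms(1), of "\<lambda>x. d * R x" M] f_bounds by blast
  have close: "cmod (fourier_ind N A r - of_real d * F r) \<le> 220 * sqrt (real N)" if "r \<in> ZN N" for r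
    using A(3)[OF that] by (simp add: F_def sum_distrib_left mult.assoc)
  have zero: "0 \<in> ZN N" using assms(1) by (simp add: ZN_def)
  have neg_ZN: "neg_set N L \<subseteq> ZN N" using assms(1) by (auto simp: neg_set_def ZN_def)

  \<comment> \<open>Comparison of the spectrum with the threshold\<close>
  have large_0: "\<alpha> * real N \<le> cmod (fourier_ind N A 0)"
  proof -
    have "cmod (fourier_ind N A 0) = real M" using A by (simp add: fourier_ind_def)
    moreover have "2 * \<alpha> \<le> \<delta>" using assms(4) \<open>\<delta> > 0\<close> by simp
    then have "2 * \<alpha> * real N \<le> \<delta> * real N" using N by (intro mult_right_mono) auto
    ultimately show ?thesis using M by linarith
  qed
  \<comment> \<open>The rounding error 220 sqrt N is less than 220/640 of \<alpha> N, so from at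
    least 2 \<alpha> N more than \<alpha> N remains.\<close>
  have large_L: "\<alpha> * real N \<le> cmod (fourier_ind N A r)" if r: "r \<in> L \<union> neg_set N L" for r
  proof -
    have "2 * (\<alpha> * real N) = \<delta> / 2 * (real N * (a / 4))"
      using \<open>\<delta> > 0\<close> by (simp add: a_def)
    also have "\<dots> \<le> d * (real N * (a / 4))"
      using d a0 by (intro mult_right_mono) auto
    also have "\<dots> = cmod (of_real d * F r)"
      unfolding transform(2)[OF r] norm_mult using d a0 by simp
    finally have "2 * (\<alpha> * real N) \<le> cmod (of_real d * F r)" .
    moreover have "r \<in> ZN N" using r LZ neg_ZN by auto
    ultimately show ?thesis
      using close[of r] \<alpha>N sqrt_ge_1 norm_triangle_ineq2[of "of_real d * F r" "fourier_ind N A r"]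
      unfolding norm_minus_commute[of "of_real d * F r"] by linarith
  qed
  have small: "cmod (fourier_ind N A r) < \<alpha> * real N" if r: "r \<in> ZN N" "r \<notin> {0} \<union> L \<union> neg_set N L" for r
  proof -
    have "cmod (of_real d * F r) \<le> \<delta> * (real N * (a / 2)\<^sup>2)"
      unfolding norm_mult using transform(3)[OF r] d by (intro mult_mono) auto
    \<comment> \<open>Here \<delta> (a / 2)^2 = 64 \<alpha>^2 / \<delta>, which is at most \<alpha>
      / 2^21 because \<alpha> / \<delta> <= 2^(-27). A bound of half the threshold already leaves
      room for the rounding error.\<close>
    also have "\<dots> = 64 * \<alpha> * real N * (\<alpha> / \<delta>)"
      using \<open>\<delta> > 0\<close> by (simp add: a_def power2_eq_square)
    also have "\<dots> \<le> 64 * \<alpha> * real N * (1 / 2 ^ 27)"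
      using assms(4) \<open>\<alpha> > 0\<close> \<open>\<delta> > 0\<close> by (intro mult_left_mono) (auto simp: field_simps)
    finally have "cmod (of_real d * F r) \<le> (\<alpha> * real N) / 2 ^ 21" by simp
    moreover have "0 \<le> \<alpha> * real N" using \<open>\<alpha> > 0\<close> N by simp
    ultimately have "cmod (of_real d * F r) \<le> (\<alpha> * real N) / 2" by simp
    then show ?thesis
      using close[OF r(1)] \<alpha>N sqrt_ge_1 norm_triangle_ineq2[of "fourier_ind N A r" "of_real d * F r"]
      by linarith
  qed
  have "large_spectrum N \<alpha> A = {0} \<union> L \<union> neg_set N L"
    unfolding large_spectrum_def using large_0 large_L small zero LZ neg_ZN by (fastforce simp: not_less[symmetric])
  then show ?thesis using A(1,2) transform(4-6) unfolding M_def by blast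
qed

end
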